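(* Let $(\bar x,\bar y)\in S^o_{\rm Lag}(\bar p)$, where $\bar p=(\bar w,0,0)$. Let $f_\nu:\mathbb R^n\times\mathbb R^d\to\mathbb R$ ($\nu=1,\dots,N$) and $F:\mathbb R^n\times\mathbb R^d\to\mathcal Y$ be twice differentiable with respect to $x$ in a neighborhood of $(\bar x,\bar w)$, and suppose that $f_\nu$, $F$, $\nabla_xf_\nu$ and ${\rm D}_xF$ are strictly differentiable with respect to $(x,w)$ in this neighborhood. Then $S^o_{\rm Lag}$ has the Aubin property at $\bar p$ for $(\bar x,\bar y)$ if and only if the following implication holds for all $w_1\in\mathbb R^n$, $w_2\in\mathcal Y$: $$\left.\begin{array}{l}\mathbf G^*w_1-{\rm D}g(\bar x)^*w_2\in D^*N_X(\bar x\,|\,-\bar q_1-\mathbf G\bar x-{\rm D}g(\bar x)^*\bar y)(-w_1)\\ {\rm D}g(\bar x)w_1\in D^*N_{K^\circ}(\bar y\,|\,g(\bar x))(-w_2)\end{array}\right\}\Longrightarrow w_1=0,\ w_2=0.$$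
   Context: **Setting (shared constraint).** There are $N$ players, $n=n_1+\dots+n_N$, $x=(x^1,\dots,x^N)\in\mathbb R^n$ with $x^\nu\in\mathbb R^{n_\nu}$, and $x^{-\nu}$ denotes the other blocks. $X_\nu\subset\mathbb R^{n_\nu}$ is nonempty closed convex, $X=\prod_\nu X_\nu$; $\mathcal Y$ is a finite-dimensional Hilbert space; $K\subset\mathcal Y$ is a nonempty closed convex cone with polar $K^\circ=\{y:\langle y,k\rangle\le0\ \forall k\in K\}$. Given $p=(w,v,u)\in\mathbb R^d\times\mathbb R^n\times\mathcal Y$, player $\nu$ minimizes $f_\nu(x^\nu,x^{-\nu};w)-\langle v^\nu,x^\nu\rangle$ over $x^\nu\in X_\nu$ subject to the shared constraint $F(x^\nu,x^{-\nu};w)-u\in K$. With a common multiplier $y$ for all players, $L_\nu(x,y;w,v^\nu,u)=f_\nu(x;w)-\langle v^\nu,x^\nu\rangle+\langle y,F(x;w)-u\rangle$, and the set of consensus Lagrangian generalized Nash equilibria is $$S^o_{\rm Lag}(p)=\{(x,y)\in\mathbb R^n\times\mathcal Y:\ 0\in\nabla_{x^\nu}L_\nu(x,y;w,v^\nu,u)+N_{X_\nu}(x^\nu),\ \nu=1,\dots,N,\ \ 0\in-F(x;w)+u+N_{K^\circ}(y)\},$$ where $N_C$ is the normal cone mapping of convex analysis (empty off $C$). **Linearization data.** Fix $\bar w\in\mathbb R^d$; $\theta_\nu=f_\nu(\cdot;\bar w)$, $g=F(\cdot;\bar w)$, $l_\nu(x,y)=\theta_\nu(x)+\langle y,g(x)\rangle$,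 $\mathbf l(x,y)=(\nabla_{x^\nu}l_\nu(x,y))_{\nu=1}^N$. $\mathbf G$ is the $n\times n$ matrix with $(\nu,\mu)$ block $\nabla^2_{x^\nu x^\mu}l_\nu(\bar x,\bar y)$ (derivative in $x^\mu$ of $\nabla_{x^\nu}l_\nu$). $\bar q_1=\mathbf l(\bar x,\bar y)-\mathbf G\bar x-{\rm D}g(\bar x)^*\bar y$ (so $-\bar q_1-\mathbf G\bar x-{\rm D}g(\bar x)^*\bar y=-\mathbf l(\bar x,\bar y)$). $^*$ on a linear operator is the adjoint. **Variational notions.** For a set-valued $S$ with $(\bar a,\bar b)\in{\rm gph}\,S$, the coderivative is $D^*S(\bar a|\bar b)(v)=\{w:(w,-v)\in N_{{\rm gph}S}(\bar a,\bar b)\}$, with $N_{{\rm gph}S}$ the limiting (Mordukhovich) normal cone. $S$ has the Aubin property at $\bar a$ for $\bar b\in S(\bar a)$ if there are neighborhoods $U$ of $\bar a$, $V$ of $\bar b$ and $\kappa>0$ with $S(a)\cap V\subset S(a')+\kappa\|a'-a\|\mathbf B$ for all $a,a'\in U$ ($\mathbf B$ the closed unit ball). *)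

theory Defs
  imports "HOL-Analysis.Analysis"
begin

section \<open>Block structure\<close>

text \<open>
  The decomposition of \<open>real ^ 'n\<close> into blocks, one per player in the finite type \<open>'p\<close>, is given
  by a map \<open>own :: 'n \<Rightarrow> 'p\<close> telling which player owns which coordinate. The block dimension
  \<open>n\<^sub>\<nu>\<close> is \<open>card {i. own i = \<nu>}\<close>, and the space of strategies of player \<open>\<nu>\<close> is identified with the
  subspace of vectors supported on the coordinates of \<open>\<nu>\<close>.
\<close>

definition block_space :: "('n \<Rightarrow> 'p) \<Rightarrow> 'p \<Rightarrow> (real ^ 'n::finite) set" where
  "block_space own \<nu> = {x. \<forall>i. own i \<noteq> \<nu> \<longrightarrow> x $ i = 0}"

definition block :: "('n \<Rightarrow> 'p) \<Rightarrow> 'p \<Rightarrow> real ^ 'n::finite \<Rightarrow> real ^ 'n" where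
  "block own \<nu> x = (\<chi> i. if own i = \<nu> then x $ i else 0)"

text \<open>The point \<open>(\<xi>\<^sup>\<nu>, x\<^sup>-\<^sup>\<nu>)\<close>; only the \<open>\<nu>\<close>-block of \<open>\<xi>\<close> matters.\<close>

definition block_subst :: "('n \<Rightarrow> 'p) \<Rightarrow> 'p \<Rightarrow> real ^ 'n::finite \<Rightarrow> real ^ 'n \<Rightarrow> real ^ 'n" where
  "block_subst own \<nu> \<xi> x = (\<chi> i. if own i = \<nu> then \<xi> $ i else x $ i)"

definition block_product :: "('n \<Rightarrow> 'p) \<Rightarrow> ('p \<Rightarrow> (real ^ 'n::finite) set) \<Rightarrow> (real ^ 'n) set" where
  "block_product own X = {x. \<forall>\<nu>. block own \<nu> x \<in> X \<nu>}"


section \<open>Derivatives\<close>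

text \<open>Unspecified where the function is not differentiable.\<close>

definition grad :: "('a::real_inner \<Rightarrow> real) \<Rightarrow> 'a \<Rightarrow> 'a" where
  "grad \<phi> x = (THE D. GDERIV \<phi> x :> D)"

text \<open>
  The partial gradient with respect to the block of \<open>\<nu>\<close>. The function of \<open>\<xi>\<close> depends on the
  \<open>\<nu>\<close>-block of \<open>\<xi>\<close> only, so where it is differentiable its gradient lies in \<open>block_space own \<nu>\<close>.
\<close>

definition block_grad ::
  "('n \<Rightarrow> 'p) \<Rightarrow> 'p \<Rightarrow> (real ^ 'n::finite \<Rightarrow> real) \<Rightarrow> real ^ 'n \<Rightarrow> real ^ 'n" where
  "block_grad own \<nu> \<phi> x = grad (\<lambda>\<xi>. \<phi> (block_subst own \<nu> \<xi> x)) x"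

definition D\<^sub>x ::
  "('a::euclidean_space \<times> 'b \<Rightarrow> 'c::real_normed_vector) \<Rightarrow> 'a \<times> 'b \<Rightarrow> 'a \<Rightarrow>\<^sub>L 'c" where
  "D\<^sub>x \<phi> = (\<lambda>(x, w). Blinfun (frechet_derivative (\<lambda>\<xi>. \<phi> (\<xi>, w)) (at x)))"

definition grad\<^sub>x :: "('a::real_inner \<times> 'b \<Rightarrow> real) \<Rightarrow> 'a \<times> 'b \<Rightarrow> 'a" where
  "grad\<^sub>x \<phi> = (\<lambda>(x, w). grad (\<lambda>\<xi>. \<phi> (\<xi>, w)) x)"

definition twice_differentiable_x ::
  "('a::euclidean_space \<times> 'b \<Rightarrow> 'c::real_normed_vector) \<Rightarrow> 'a \<times> 'b \<Rightarrow> bool" where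
  "twice_differentiable_x \<phi> = (\<lambda>(x, w).
     (\<forall>\<^sub>F \<xi> in nhds x. (\<lambda>\<xi>. \<phi> (\<xi>, w)) differentiable (at \<xi>)) \<and>
     (\<lambda>\<xi>. D\<^sub>x \<phi> (\<xi>, w)) differentiable (at x))"

definition strictly_differentiable ::
  "('a::real_normed_vector \<Rightarrow> 'b::real_normed_vector) \<Rightarrow> 'a \<Rightarrow> bool" where
  "strictly_differentiable \<phi> z \<longleftrightarrow>
     (\<exists>\<phi>'. bounded_linear \<phi>' \<and>
        (\<forall>\<epsilon>>0. \<exists>\<delta>>0. \<forall>a\<in>ball z \<delta>. \<forall>b\<in>ball z \<delta>.
           norm (\<phi> a - \<phi> b - \<phi>' (a - b)) \<le> \<epsilon> * norm (a - b)))"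


section \<open>Variational analysis\<close>

definition normal_cone :: "'a::real_inner set \<Rightarrow> 'a \<Rightarrow> 'a set" where
  "normal_cone C x = (if x \<in> C then {v. \<forall>z\<in>C. v \<bullet> (z - x) \<le> 0} else {})"

definition polar :: "'a::real_inner set \<Rightarrow> 'a set" where
  "polar K = {y. \<forall>k\<in>K. y \<bullet> k \<le> 0}"

definition gph :: "('a \<Rightarrow> 'b set) \<Rightarrow> ('a \<times> 'b) set" where
  "gph S = {(a, b). b \<in> S a}"

definition regular_normal_cone :: "'a::real_inner set \<Rightarrow> 'a \<Rightarrow> 'a set" where
  "regular_normal_cone C x =
     (if x \<in> C
      then {v. \<forall>\<epsilon>>0. \<forall>\<^sub>F z in at x within C. v \<bullet> (z - x) \<le> \<epsilon> * norm (z - x)}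
      else {})"

definition limiting_normal_cone :: "'a::real_inner set \<Rightarrow> 'a \<Rightarrow> 'a set" where
  "limiting_normal_cone C x =
     (if x \<in> C
      then {v. \<exists>z u. (\<forall>k::nat. u k \<in> regular_normal_cone C (z k)) \<and>
                     z \<longlonglongrightarrow> x \<and> u \<longlonglongrightarrow> v}
      else {})"

definition coderivative ::
  "('a::real_inner \<Rightarrow> 'b::real_inner set) \<Rightarrow> 'a \<Rightarrow> 'b \<Rightarrow> 'b \<Rightarrow> 'a set" where
  "coderivative S a b v = {w. (w, - v) \<in> limiting_normal_cone (gph S) (a, b)}"

text \<open>\<open>S a' + (*\<^sub>R) c ` cball 0 1\<close> is the Minkowski sum of \<open>S a'\<close> and the ball of radius \<open>c\<close>.\<close>

definition aubin_property ::
  "('a::real_normed_vector \<Rightarrow> 'b::real_normed_vector set) \<Rightarrow> 'a \<Rightarrow> 'b \<Rightarrow> bool" where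
  "aubin_property S a0 b0 \<longleftrightarrow>
     b0 \<in> S a0 \<and>
     (\<exists>U V \<kappa>. open U \<and> a0 \<in> U \<and> open V \<and> b0 \<in> V \<and> \<kappa> > 0 \<and>
        (\<forall>a\<in>U. \<forall>a'\<in>U. S a \<inter> V \<subseteq> S a' + (*\<^sub>R) (\<kappa> * norm (a' - a)) ` cball 0 1))"


section \<open>The generalized Nash equilibrium problem\<close>

definition lagrangian ::
  "('n \<Rightarrow> 'p) \<Rightarrow> ('p \<Rightarrow> (real ^ 'n::finite) \<times> 'w \<Rightarrow> real) \<Rightarrow> ((real ^ 'n) \<times> 'w \<Rightarrow> 'y::real_inner) \<Rightarrow>
   'p \<Rightarrow> real ^ 'n \<Rightarrow> 'y \<Rightarrow> 'w \<times> (real ^ 'n) \<times> 'y \<Rightarrow> real" where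
  "lagrangian own f F \<nu> x y = (\<lambda>(w, v, u).
     f \<nu> (x, w) - block own \<nu> v \<bullet> block own \<nu> x + y \<bullet> (F (x, w) - u))"

text \<open>
  The normal cone to \<open>X \<nu>\<close> is taken in the strategy space of player \<open>\<nu>\<close>, hence the intersection
  with \<open>block_space own \<nu>\<close>.
\<close>

definition S_Lag ::
  "('n \<Rightarrow> 'p) \<Rightarrow> ('p \<Rightarrow> (real ^ 'n::finite) \<times> 'w \<Rightarrow> real) \<Rightarrow> ((real ^ 'n) \<times> 'w \<Rightarrow> 'y::real_inner) \<Rightarrow>
   ('p \<Rightarrow> (real ^ 'n) set) \<Rightarrow> 'y set \<Rightarrow> 'w \<times> (real ^ 'n) \<times> 'y \<Rightarrow> ((real ^ 'n) \<times> 'y) set" where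
  "S_Lag own f F X K = (\<lambda>(w, v, u). {(x, y).
     (\<forall>\<nu>. 0 \<in> (+) (block_grad own \<nu> (\<lambda>\<xi>. lagrangian own f F \<nu> \<xi> y (w, v, u)) x) `
                (normal_cone (X \<nu>) (block own \<nu> x) \<inter> block_space own \<nu>)) \<and>
     0 \<in> (+) (- F (x, w) + u) ` normal_cone (polar K) y})"

definition pseudogradient ::
  "('n \<Rightarrow> 'p) \<Rightarrow> ('p \<Rightarrow> real ^ 'n::finite \<Rightarrow> 'y \<Rightarrow> real) \<Rightarrow> real ^ 'n \<Rightarrow> 'y \<Rightarrow> real ^ 'n" where
  "pseudogradient own l x y = (\<chi> i. block_grad own (own i) (\<lambda>\<xi>. l (own i) \<xi> y) x $ i)"

text \<open>
  The entry \<open>(i, j)\<close>, with \<open>i\<close> owned by \<open>\<nu>\<close> and \<open>j\<close> by \<open>\<mu>\<close>, comes from the derivative of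
  \<open>block_grad own \<nu> (l \<nu>)\<close> in the variable \<open>x\<^sup>\<mu>\<close>.
\<close>

definition pseudohessian ::
  "('n \<Rightarrow> 'p) \<Rightarrow> ('p \<Rightarrow> real ^ 'n::finite \<Rightarrow> 'y \<Rightarrow> real) \<Rightarrow> real ^ 'n \<Rightarrow> 'y \<Rightarrow> real ^ 'n ^ 'n" where
  "pseudohessian own l x y = (\<chi> i j.
     frechet_derivative
       (\<lambda>\<xi>. block_grad own (own i) (\<lambda>z. l (own i) z y) (block_subst own (own j) \<xi> x))
       (at x) (axis j 1) $ i)"

end

theory Submission
  imports Defs
begin

text \<open>
  With \<open>z = (x, y)\<close> and \<open>r = (v, -u)\<close>, the equilibrium conditions read \<open>r - H (z, w) \<in> M z\<close>,
  where \<open>M = N\<^sub>X \<times> N\<^sub>K\<^sub>\<circ>\<close> has closed graph and \<open>H\<close> is strictly differentiable; let \<open>A\<close> be its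
  partial derivative in \<open>z\<close>. Since \<open>r\<close> enters as a pure translation, moving \<open>r\<close> in the
  direction \<open>\<beta>\<close> shows that under the Aubin property with modulus \<open>\<kappa>\<close> every regular normal
  \<open>(\<alpha>, \<beta>)\<close> to the graph of \<open>M\<close> near the base point has, up to a small error, \<open>\<bar>\<beta>\<bar> \<le> \<kappa> \<bar>\<alpha> - A\<^sup>* \<beta>\<bar>\<close>;
  in the limit \<open>(A\<^sup>* \<zeta>, \<zeta>)\<close> is a limiting normal only for \<open>\<zeta> = 0\<close>.
  Conversely, if the Aubin property fails, minimising over the graph of \<open>M\<close> the residual
  \<open>\<bar>m + H (z, w') - r'\<bar>\<close> plus a quadratic penalty \<open>a \<bar>z - z\<^sub>0\<bar>\<^sup>2\<close> yields a point where the residual is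
  positive and the penalty has small gradient, hence a regular normal \<open>(\<alpha>, \<beta>)\<close> with \<open>\<bar>\<beta>\<bar> = 1\<close> and
  \<open>\<alpha> \<approx> A\<^sup>* \<beta>\<close>; compactness of the unit sphere gives a nonzero \<open>\<zeta>\<close>.
\<close>


section \<open>Strict derivatives\<close>


text \<open>Relational form of \<open>strictly_differentiable\<close>: carrying the derivative as an
  argument lets the chain rule name it and lets its partial part be identified with a given
  map.\<close>

definition has_strict_derivative ::
  "('a::real_normed_vector \<Rightarrow> 'b::real_normed_vector) \<Rightarrow> ('a \<Rightarrow> 'b) \<Rightarrow> 'a \<Rightarrow> bool" where
  "has_strict_derivative f f' z \<longleftrightarrow> bounded_linear f' \<and>
     (\<forall>\<epsilon>>0. \<exists>\<delta>>0. \<forall>a\<in>ball z \<delta>. \<forall>b\<in>ball z \<delta>.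
        norm (f a - f b - f' (a - b)) \<le> \<epsilon> * norm (a - b))"

lemma strictly_differentiable_iff:
  "strictly_differentiable f z \<longleftrightarrow> (\<exists>f'. has_strict_derivative f f' z)"
  by (simp add: strictly_differentiable_def has_strict_derivative_def)

lemma has_strict_derivativeD:
  assumes "has_strict_derivative f f' z" "\<epsilon> > 0"
  obtains \<delta> where "\<delta> > 0"
    "\<And>a b. a \<in> ball z \<delta> \<Longrightarrow> b \<in> ball z \<delta> \<Longrightarrow> norm (f a - f b - f' (a - b)) \<le> \<epsilon> * norm (a - b)"
  using assms unfolding has_strict_derivative_def by blast

lemma has_strict_derivative_imp_has_derivative:
  assumes "has_strict_derivative f f' z"
  shows "(f has_derivative f') (at z)"
  unfolding has_derivative_at_alt
proof (intro conjI allI impI)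
  show "bounded_linear f'"
    using assms by (simp add: has_strict_derivative_def)
  fix e :: real assume "e > 0"
  with assms obtain \<delta> where \<delta>: "\<delta> > 0"
    "\<And>a b. a \<in> ball z \<delta> \<Longrightarrow> b \<in> ball z \<delta> \<Longrightarrow> norm (f a - f b - f' (a - b)) \<le> e * norm (a - b)"
    by (rule has_strict_derivativeD) blast
  then show "\<exists>d>0. \<forall>y. norm (y - z) < d \<longrightarrow> norm (f y - f z - f' (y - z)) \<le> e * norm (y - z)"
    by (intro exI[of _ \<delta>]) (auto simp: dist_norm norm_minus_commute)
qed

lemma strictly_differentiable_imp_differentiable:
  "strictly_differentiable f z \<Longrightarrow> f differentiable (at z)"
  unfolding strictly_differentiable_iff differentiable_def
  using has_strict_derivative_imp_has_derivative by blast

text \<open>The error tolerance 1 plus a bound B on the derivative gives the Lipschitz constant B +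
  1 for all pairs of points near z.\<close>

lemma has_strict_derivative_local_lipschitz:
  assumes "has_strict_derivative f f' z"
  obtains \<delta> L where "\<delta> > 0" "L > 0"
    "\<And>a b. a \<in> ball z \<delta> \<Longrightarrow> b \<in> ball z \<delta> \<Longrightarrow> norm (f a - f b) \<le> L * norm (a - b)"
proof -
  obtain B where B: "B > 0" "\<And>x. norm (f' x) \<le> norm x * B"
    using assms bounded_linear.pos_bounded unfolding has_strict_derivative_def by blast
  obtain \<delta> where \<delta>: "\<delta> > 0"
    "\<And>a b. a \<in> ball z \<delta> \<Longrightarrow> b \<in> ball z \<delta> \<Longrightarrow> norm (f a - f b - f' (a - b)) \<le> 1 * norm (a - b)"
    using assms zero_less_one by (rule has_strict_derivativeD) blast
  have "norm (f a - f b) \<le> (B + 1) * norm (a - b)" if "a \<in> ball z \<delta>" "b \<in> ball z \<delta>" for a b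
    using \<delta>(2)[OF that] B(2)[of "a - b"] norm_triangle_sub[of "f a - f b" "f' (a - b)"]
    by (simp add: algebra_simps)
  with \<delta>(1) B(1) show thesis
    by (intro that[of \<delta> "B + 1"]) auto
qed

text \<open>The error splits into the error of g at the increment f a - f b, controlled by the
  Lipschitz constant L of f, and the image under g' of the error of f, controlled by the bound B on
  g'. Each receives half of \<epsilon>, hence the tolerances \<epsilon> / (2 L) and \<epsilon> / (2
  B).\<close>

lemma has_strict_derivative_compose:
  assumes f: "has_strict_derivative f f' z" and g: "has_strict_derivative g g' (f z)"
  shows "has_strict_derivative (\<lambda>x. g (f x)) (\<lambda>x. g' (f' x)) z"
  unfolding has_strict_derivative_def
proof (intro conjI allI impI)
  show "bounded_linear (\<lambda>x. g' (f' x))"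
    using f g by (simp add: has_strict_derivative_def bounded_linear_compose)
  fix \<epsilon> :: real assume \<epsilon>: "\<epsilon> > 0"
  obtain \<delta>1 L where L: "\<delta>1 > 0" "L > 0"
    "\<And>a b. a \<in> ball z \<delta>1 \<Longrightarrow> b \<in> ball z \<delta>1 \<Longrightarrow> norm (f a - f b) \<le> L * norm (a - b)"
    using has_strict_derivative_local_lipschitz[OF f] by blast
  obtain B where B: "B > 0" "\<And>x. norm (g' x) \<le> norm x * B"
    using g bounded_linear.pos_bounded unfolding has_strict_derivative_def by blast
  have g'diff: "g' (x - y) = g' x - g' y" for x y
    using g by (simp add: has_strict_derivative_def bounded_linear.linear linear_diff)
  have "\<epsilon> / (2 * L) > 0" "\<epsilon> / (2 * B) > 0"
    using \<epsilon> L(2) B(1) by auto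
  obtain \<delta>2 where \<delta>2: "\<delta>2 > 0" "\<And>a b. a \<in> ball (f z) \<delta>2 \<Longrightarrow> b \<in> ball (f z) \<delta>2 \<Longrightarrow>
      norm (g a - g b - g' (a - b)) \<le> \<epsilon> / (2 * L) * norm (a - b)"
    using g \<open>\<epsilon> / (2 * L) > 0\<close> by (rule has_strict_derivativeD) blast
  obtain \<delta>3 where \<delta>3: "\<delta>3 > 0" "\<And>a b. a \<in> ball z \<delta>3 \<Longrightarrow> b \<in> ball z \<delta>3 \<Longrightarrow>
      norm (f a - f b - f' (a - b)) \<le> \<epsilon> / (2 * B) * norm (a - b)"
    using f \<open>\<epsilon> / (2 * B) > 0\<close> by (rule has_strict_derivativeD) blast
  \<comment> \<open>The bound \<delta>2 / L makes f map the ball around z into the ball around f z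
    where g is well approximated.\<close>
  define \<delta> where "\<delta> = min (min \<delta>1 \<delta>3) (\<delta>2 / L)"
  have "\<delta> > 0"
    using L \<delta>2 \<delta>3 by (simp add: \<delta>_def)
  moreover have "norm (g (f a) - g (f b) - g' (f' (a - b))) \<le> \<epsilon> * norm (a - b)"
    if a: "a \<in> ball z \<delta>" and b: "b \<in> ball z \<delta>" for a b
  proof -
    have mem: "f c \<in> ball (f z) \<delta>2" if "c \<in> ball z \<delta>" for c
    proof -
      have "norm (f z - f c) \<le> L * norm (z - c)"
        using that L by (intro L(3)) (auto simp: \<delta>_def)
      also have "\<dots> < \<delta>2"
        using that L(2) by (auto simp: \<delta>_def dist_norm field_simps)
      finally show ?thesis
        by (simp add: dist_norm)
    qed
    have ab: "a \<in> ball z \<delta>1" "b \<in> ball z \<delta>1" "a \<in> ball z \<delta>3" "b \<in> ball z \<delta>3"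
      using a b by (auto simp: \<delta>_def)
    have "norm (g (f a) - g (f b) - g' (f a - f b)) \<le> \<epsilon> / (2 * L) * norm (f a - f b)"
      using \<delta>2(2)[OF mem[OF a] mem[OF b]] .
    also have "\<dots> \<le> \<epsilon> / (2 * L) * (L * norm (a - b))"
      using L(3)[OF ab(1,2)] \<epsilon> L(2) by (intro mult_left_mono) auto
    also have "\<dots> = \<epsilon> / 2 * norm (a - b)"
      using L(2) by simp
    finally have 1: "norm (g (f a) - g (f b) - g' (f a - f b)) \<le> \<epsilon> / 2 * norm (a - b)" .
    have "norm (g' (f a - f b - f' (a - b))) \<le> norm (f a - f b - f' (a - b)) * B"
      by (rule B(2))
    also have "\<dots> \<le> \<epsilon> / (2 * B) * norm (a - b) * B"
      using \<delta>3(2)[OF ab(3,4)] B(1) by (intro mult_right_mono) auto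
    also have "\<dots> = \<epsilon> / 2 * norm (a - b)"
      using B(1) by simp
    finally have 2: "norm (g' (f a - f b) - g' (f' (a - b))) \<le> \<epsilon> / 2 * norm (a - b)"
      by (simp add: g'diff)
    show ?thesis
      using norm_triangle_ineq[of "g (f a) - g (f b) - g' (f a - f b)" "g' (f a - f b) - g' (f' (a - b))"] 1 2
      by simp
  qed
  ultimately show "\<exists>\<delta>>0. \<forall>a\<in>ball z \<delta>. \<forall>b\<in>ball z \<delta>.
      norm (g (f a) - g (f b) - g' (f' (a - b))) \<le> \<epsilon> * norm (a - b)"
    by blast
qed

lemma strictly_differentiable_compose:
  assumes "strictly_differentiable f z" "strictly_differentiable g (f z)"
  shows "strictly_differentiable (\<lambda>x. g (f x)) z"
  using assms has_strict_derivative_compose unfolding strictly_differentiable_iff by blast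

lemma strictly_differentiable_bounded_linear:
  assumes "bounded_linear f"
  shows "strictly_differentiable f z"
  unfolding strictly_differentiable_def using assms
  by (intro exI[of _ f]) (auto simp: bounded_linear.linear linear_diff intro: exI[of _ 1])

lemma strictly_differentiable_Pair:
  assumes "strictly_differentiable f z" "strictly_differentiable g z"
  shows "strictly_differentiable (\<lambda>x. (f x, g x)) z"
proof -
  obtain f' g' where fg: "has_strict_derivative f f' z" "has_strict_derivative g g' z"
    using assms unfolding strictly_differentiable_iff by blast
  have "has_strict_derivative (\<lambda>x. (f x, g x)) (\<lambda>x. (f' x, g' x)) z"
    unfolding has_strict_derivative_def
  proof (intro conjI allI impI)
    show "bounded_linear (\<lambda>x. (f' x, g' x))"
      using fg by (simp add: has_strict_derivative_def bounded_linear_Pair)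
    fix \<epsilon> :: real assume \<epsilon>: "\<epsilon> > 0"
    then have "\<epsilon> / 2 > 0" by simp
    obtain \<delta>1 where 1: "\<delta>1 > 0" "\<And>a b. a \<in> ball z \<delta>1 \<Longrightarrow> b \<in> ball z \<delta>1 \<Longrightarrow>
        norm (f a - f b - f' (a - b)) \<le> \<epsilon> / 2 * norm (a - b)"
      using fg(1) \<open>\<epsilon> / 2 > 0\<close> by (rule has_strict_derivativeD) blast
    obtain \<delta>2 where 2: "\<delta>2 > 0" "\<And>a b. a \<in> ball z \<delta>2 \<Longrightarrow> b \<in> ball z \<delta>2 \<Longrightarrow>
        norm (g a - g b - g' (a - b)) \<le> \<epsilon> / 2 * norm (a - b)"
      using fg(2) \<open>\<epsilon> / 2 > 0\<close> by (rule has_strict_derivativeD) blast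
    have "norm ((f a, g a) - (f b, g b) - (f' (a - b), g' (a - b))) \<le> \<epsilon> * norm (a - b)"
      if "a \<in> ball z (min \<delta>1 \<delta>2)" "b \<in> ball z (min \<delta>1 \<delta>2)" for a b
      using norm_Pair_le[of "f a - f b - f' (a - b)" "g a - g b - g' (a - b)"]
        1(2)[of a b] 2(2)[of a b] that by simp
    then show "\<exists>\<delta>>0. \<forall>a\<in>ball z \<delta>. \<forall>b\<in>ball z \<delta>.
        norm ((f a, g a) - (f b, g b) - (f' (a - b), g' (a - b))) \<le> \<epsilon> * norm (a - b)"
      using 1(1) 2(1) by (intro exI[of _ "min \<delta>1 \<delta>2"]) auto
  qed
  then show ?thesis
    unfolding strictly_differentiable_iff by blast
qed

lemma strictly_differentiable_add:
  assumes "strictly_differentiable f z" "strictly_differentiable g z"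
  shows "strictly_differentiable (\<lambda>x. f x + g x) z"
proof -
  have "bounded_linear (\<lambda>p. fst p + snd p :: 'b)"
    by (intro bounded_linear_add bounded_linear_fst bounded_linear_snd)
  from strictly_differentiable_compose[OF strictly_differentiable_Pair[OF assms]
      strictly_differentiable_bounded_linear[OF this]]
  show ?thesis by simp
qed

lemma strictly_differentiable_sum:
  assumes "\<And>i. i \<in> I \<Longrightarrow> strictly_differentiable (f i) z"
  shows "strictly_differentiable (\<lambda>x. \<Sum>i\<in>I. f i x) z"
  using assms
proof (induction I rule: infinite_finite_induct)
  case (insert i I)
  then show ?case
    using strictly_differentiable_add[of "f i" z "\<lambda>x. \<Sum>i\<in>I. f i x"] by simp
qed (auto intro: strictly_differentiable_bounded_linear bounded_linear_zero)

text \<open>After subtracting the product-rule derivative at (x, y), two terms remain, each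
  containing one increment of p - q and one deviation from (x, y); on a ball of radius \<epsilon> /
  (2 B) each is at most half of the allowed error.\<close>

lemma strictly_differentiable_bilinear:
  assumes "bounded_bilinear h"
  shows "strictly_differentiable (\<lambda>p. h (fst p) (snd p)) z"
proof -
  interpret bounded_bilinear h by (fact assms)
  obtain B where B: "B > 0" "\<And>a b. norm (h a b) \<le> norm a * norm b * B"
    using pos_bounded by blast
  obtain x y where z: "z = (x, y)" by fastforce
  have "has_strict_derivative (\<lambda>p. h (fst p) (snd p)) (\<lambda>p. h x (snd p) + h (fst p) y) z"
    unfolding has_strict_derivative_def
  proof (intro conjI allI impI)
    show "bounded_linear (\<lambda>p. h x (snd p) + h (fst p) y)"
      by (intro bounded_linear_add bounded_linear_compose[OF bounded_linear_right]
          bounded_linear_compose[OF bounded_linear_left] bounded_linear_fst bounded_linear_snd)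
    fix \<epsilon> :: real assume \<epsilon>: "\<epsilon> > 0"
    define \<delta> where "\<delta> = \<epsilon> / (2 * B)"
    have "\<delta> > 0" using \<epsilon> B by (simp add: \<delta>_def)
    moreover have "norm (h (fst p) (snd p) - h (fst q) (snd q)
         - (h x (snd (p - q)) + h (fst (p - q)) y)) \<le> \<epsilon> * norm (p - q)"
      if "p \<in> ball z \<delta>" "q \<in> ball z \<delta>" for p q
    proof -
      have "dist (fst p) (fst z) \<le> \<delta>" "dist (snd q) (snd z) \<le> \<delta>"
        using that dist_fst_le[of p z] dist_snd_le[of q z] unfolding mem_ball dist_commute[of z] by linarith+
      then have p: "norm (fst p - x) \<le> \<delta>" and q: "norm (snd q - y) \<le> \<delta>"
        by (simp_all add: z dist_norm)
      have n: "norm (fst (p - q)) \<le> norm (p - q)" "norm (snd (p - q)) \<le> norm (p - q)"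
        by (metis norm_fst_le norm_snd_le prod.collapse)+
      have "h (fst p) (snd p) - h (fst q) (snd q) - (h x (snd (p - q)) + h (fst (p - q)) y)
          = h (fst p - x) (snd (p - q)) + h (fst (p - q)) (snd q - y)"
        by (simp add: diff_left diff_right algebra_simps)
      also have "norm \<dots> \<le> \<delta> * norm (p - q) * B + norm (p - q) * \<delta> * B"
      proof (intro norm_triangle_mono)
        have "norm (h (fst p - x) (snd (p - q))) \<le> norm (fst p - x) * norm (snd (p - q)) * B"
          by (rule B(2))
        also have "\<dots> \<le> \<delta> * norm (p - q) * B"
          using p n B(1) \<open>\<delta> > 0\<close> by (intro mult_right_mono mult_mono) auto
        finally show "norm (h (fst p - x) (snd (p - q))) \<le> \<delta> * norm (p - q) * B" .
        have "norm (h (fst (p - q)) (snd q - y)) \<le> norm (fst (p - q)) * norm (snd q - y) * B"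
          by (rule B(2))
        also have "\<dots> \<le> norm (p - q) * \<delta> * B"
          using q n B(1) \<open>\<delta> > 0\<close> by (intro mult_right_mono mult_mono) auto
        finally show "norm (h (fst (p - q)) (snd q - y)) \<le> norm (p - q) * \<delta> * B" .
      qed
      also have "\<dots> = \<epsilon> * norm (p - q)"
        using B(1) by (simp add: \<delta>_def field_simps)
      finally show ?thesis .
    qed
    ultimately show "\<exists>\<delta>>0. \<forall>a\<in>ball z \<delta>. \<forall>b\<in>ball z \<delta>.
        norm (h (fst a) (snd a) - h (fst b) (snd b) - (h x (snd (a - b)) + h (fst (a - b)) y))
          \<le> \<epsilon> * norm (a - b)"
      by blast
  qed
  then show ?thesis
    unfolding strictly_differentiable_iff by blast
qed

section \<open>Comparison of derivatives and partial derivatives\<close>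

text \<open>Both f' and A approximate the increment of f along t h, so they differ on t h by at most
  \<epsilon> t |h| plus a remainder that is small relative to t; divide by t. This later bounds
  partial derivatives of H at nearby points against \<open>A\<close>.\<close>

lemma derivative_bound:
  fixes f f' A :: "'a::real_normed_vector \<Rightarrow> 'b::real_normed_vector"
  assumes f: "(f has_derivative f') (at x)" and A: "bounded_linear A"
    and bound: "\<forall>\<^sub>F z in nhds x. norm (f z - f x - A (z - x)) \<le> \<epsilon> * norm (z - x)"
  shows "norm (f' h - A h) \<le> \<epsilon> * norm h"
proof (cases "h = 0")
  case True
  then show ?thesis
    using has_derivative_bounded_linear[OF f] A by (simp add: bounded_linear.linear linear_0)
next
  case False
  interpret f': bounded_linear f' using has_derivative_bounded_linear[OF f] .
  interpret A: bounded_linear A using A .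
  show ?thesis
  proof (rule field_le_epsilon)
    fix e :: real assume e: "e > 0"
    define e' where "e' = e / norm h"
    have "e' > 0" using e False by (simp add: e'_def)
    then obtain d where d: "d > 0"
      "\<And>z. norm (z - x) < d \<Longrightarrow> norm (f z - f x - f' (z - x)) \<le> e' * norm (z - x)"
      using f unfolding has_derivative_at_alt by blast
    obtain d' where d': "d' > 0"
      "\<And>z. dist z x < d' \<Longrightarrow> norm (f z - f x - A (z - x)) \<le> \<epsilon> * norm (z - x)"
      using bound unfolding eventually_nhds_metric by blast
    \<comment> \<open>The step t h is half as long as the smaller radius, so both approximations
      apply at x + t h.\<close>
    define t where "t = min d d' / (2 * norm h)"
    have t: "t > 0" "t * norm h < d" "t * norm h < d'"
      using d(1) d'(1) False by (auto simp: t_def)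
    define z where "z = x + t *\<^sub>R h"
    have "norm (f z - f x - f' (t *\<^sub>R h)) \<le> e' * (t * norm h)"
      using d(2)[of z] t by (simp add: z_def)
    moreover have "norm (f z - f x - A (t *\<^sub>R h)) \<le> \<epsilon> * (t * norm h)"
      using d'(2)[of z] t by (simp add: z_def dist_norm)
    ultimately have "norm (f' (t *\<^sub>R h) - A (t *\<^sub>R h)) \<le> \<epsilon> * (t * norm h) + e' * (t * norm h)"
      using norm_triangle_ineq4[of "f z - f x - A (t *\<^sub>R h)" "f z - f x - f' (t *\<^sub>R h)"] by simp
    moreover have "norm (f' (t *\<^sub>R h) - A (t *\<^sub>R h)) = t * norm (f' h - A h)"
      using t(1) by (simp add: f'.scaleR A.scaleR flip: scaleR_diff_right)
    moreover have "e' * (t * norm h) = t * e"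
      using False by (simp add: e'_def)
    ultimately have "t * norm (f' h - A h) \<le> t * (\<epsilon> * norm h + e)"
      by (simp add: algebra_simps)
    then show "norm (f' h - A h) \<le> \<epsilon> * norm h + e"
      using t(1) by simp
  qed
qed

lemma has_derivative_at_slice:
  fixes H :: "'a::real_normed_vector \<times> 'b::real_normed_vector \<Rightarrow> 'c::real_normed_vector"
  assumes "(H has_derivative D) (at (x, y))"
  shows "((\<lambda>z. H (z, y)) has_derivative (\<lambda>h. D (h, 0))) (at x)"
    and "((\<lambda>z. H (x, z)) has_derivative (\<lambda>h. D (0, h))) (at y)"
proof -
  have "((\<lambda>z. (z, y)) has_derivative (\<lambda>h. (h, 0))) (at x)"
       "((\<lambda>z. (x, z)) has_derivative (\<lambda>h. (0, h))) (at y)"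
    by (intro has_derivative_Pair has_derivative_ident has_derivative_const)+
  from has_derivative_compose[OF this(1) assms] has_derivative_compose[OF this(2) assms]
  show "((\<lambda>z. H (z, y)) has_derivative (\<lambda>h. D (h, 0))) (at x)"
       "((\<lambda>z. H (x, z)) has_derivative (\<lambda>h. D (0, h))) (at y)" .
qed


section \<open>Normal cones and the Aubin property\<close>


text \<open>Fermat's rule: v is minus the gradient of \<psi> at q. On C the increment of \<psi> is
  nonnegative near q, so the first-order remainder bound for \<psi> becomes the defining inequality
  of a regular normal.\<close>

lemma local_min_imp_regular_normal:
  fixes \<psi> :: "'a::real_inner \<Rightarrow> real"
  assumes \<psi>: "(\<psi> has_derivative (\<lambda>h. - (v \<bullet> h))) (at q)" and "q \<in> C"
    and le: "\<forall>\<^sub>F z in nhds q. z \<in> C \<longrightarrow> \<psi> q \<le> \<psi> z"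
  shows "v \<in> regular_normal_cone C q"
proof -
  have "\<forall>\<^sub>F z in at q within C. v \<bullet> (z - q) \<le> \<epsilon> * norm (z - q)" if \<epsilon>: "\<epsilon> > 0" for \<epsilon> :: real
  proof -
    obtain d where "d > 0"
      "\<And>z. norm (z - q) < d \<Longrightarrow> norm (\<psi> z - \<psi> q - - (v \<bullet> (z - q))) \<le> \<epsilon> * norm (z - q)"
      using \<psi> \<epsilon> unfolding has_derivative_at_alt by blast
    then have "\<forall>\<^sub>F z in nhds q. norm (\<psi> z - \<psi> q - - (v \<bullet> (z - q))) \<le> \<epsilon> * norm (z - q)"
      unfolding eventually_nhds_metric dist_norm by (intro exI[of _ d] conjI allI impI)
    with le have "\<forall>\<^sub>F z in nhds q. z \<in> C \<longrightarrow> v \<bullet> (z - q) \<le> \<epsilon> * norm (z - q)"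
      by eventually_elim auto
    then show ?thesis
      unfolding eventually_at_filter by eventually_elim auto
  qed
  with \<open>q \<in> C\<close> show ?thesis
    by (simp add: regular_normal_cone_def)
qed

text \<open>The filter excludes the base point while the metric form includes it; at z = x both
  sides of the inequality vanish.\<close>

lemma regular_normal_cone_iff:
  "v \<in> regular_normal_cone C x \<longleftrightarrow> x \<in> C \<and>
     (\<forall>\<epsilon>>0. \<exists>\<delta>>0. \<forall>z\<in>C. norm (z - x) < \<delta> \<longrightarrow> v \<bullet> (z - x) \<le> \<epsilon> * norm (z - x))"
  (is "_ \<longleftrightarrow> _ \<and> (\<forall>\<epsilon>>0. ?P \<epsilon>)")
proof -
  have "(\<forall>\<^sub>F z in at x within C. v \<bullet> (z - x) \<le> \<epsilon> * norm (z - x)) \<longleftrightarrow> ?P \<epsilon>" for \<epsilon>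
    unfolding eventually_at dist_norm
    by (metis diff_self inner_zero_right norm_zero mult_zero_right order_refl)
  then show ?thesis
    by (simp add: regular_normal_cone_def)
qed

lemma limiting_normal_coneI:
  assumes "x \<in> C" "\<And>k::nat. u k \<in> regular_normal_cone C (z k)" "z \<longlonglongrightarrow> x" "u \<longlonglongrightarrow> v"
  shows "v \<in> limiting_normal_cone C x"
  using assms by (auto simp: limiting_normal_cone_def)

lemma limiting_normal_coneE:
  assumes "v \<in> limiting_normal_cone C x"
  obtains z u where "x \<in> C" "\<And>k::nat. u k \<in> regular_normal_cone C (z k)" "z \<longlonglongrightarrow> x" "u \<longlonglongrightarrow> v"
  using assms by (auto simp: limiting_normal_cone_def split: if_splits)

lemma regular_normal_cone_subset: "v \<in> regular_normal_cone C x \<Longrightarrow> x \<in> C"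
  by (simp add: regular_normal_cone_iff)

lemma mem_plus_scaled_cball:
  fixes T :: "'a::real_normed_vector set"
  assumes "c \<ge> 0"
  shows "z \<in> T + (*\<^sub>R) c ` cball 0 1 \<longleftrightarrow> (\<exists>z'\<in>T. norm (z - z') \<le> c)"
proof
  assume "z \<in> T + (*\<^sub>R) c ` cball 0 1"
  then obtain z' u where "z' \<in> T" "norm u \<le> 1" "z = z' + c *\<^sub>R u"
    by (auto simp: set_plus_def)
  then show "\<exists>z'\<in>T. norm (z - z') \<le> c"
    using assms by (intro bexI[of _ z']) (auto intro: mult_left_le)
next
  assume "\<exists>z'\<in>T. norm (z - z') \<le> c"
  then obtain z' where z': "z' \<in> T" "norm (z - z') \<le> c" by blast
  \<comment> \<open>For c = 0 the inverse of c is 0, so u = 0, and z = z' makes the decomposition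
    correct in this case too.\<close>
  define u where "u = (z - z') /\<^sub>R c"
  have "z = z' + c *\<^sub>R u"
    using z'(2) by (cases "c = 0") (simp_all add: u_def)
  moreover have "norm u \<le> 1"
    using z'(2) assms by (cases "c = 0") (simp_all add: u_def divide_simps)
  ultimately show "z \<in> T + (*\<^sub>R) c ` cball 0 1"
    unfolding set_plus_def using z'(1) by (intro CollectI bexI[of _ z'] bexI[of _ "c *\<^sub>R u"]) auto
qed

text \<open>A single radius replaces the two neighborhoods, and an explicit nearby point replaces
  the Minkowski sum. This form is convenient both to apply and to negate.\<close>

lemma aubin_property_iff:
  "aubin_property S a0 b0 \<longleftrightarrow> b0 \<in> S a0 \<and>
     (\<exists>s>0. \<exists>\<kappa>>0. \<forall>a\<in>ball a0 s. \<forall>a'\<in>ball a0 s. \<forall>b\<in>S a \<inter> ball b0 s.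
        \<exists>b'\<in>S a'. norm (b - b') \<le> \<kappa> * norm (a' - a))"
  (is "_ \<longleftrightarrow> _ \<and> (\<exists>s>0. \<exists>\<kappa>>0. ?P s \<kappa>)")
proof (cases "b0 \<in> S a0")
  case True
  have "(\<exists>U V \<kappa>. open U \<and> a0 \<in> U \<and> open V \<and> b0 \<in> V \<and> \<kappa> > 0 \<and>
        (\<forall>a\<in>U. \<forall>a'\<in>U. S a \<inter> V \<subseteq> S a' + (*\<^sub>R) (\<kappa> * norm (a' - a)) ` cball 0 1))
      \<longleftrightarrow> (\<exists>s>0. \<exists>\<kappa>>0. ?P s \<kappa>)" (is "?L \<longleftrightarrow> ?R")
  proof
    assume ?L
    then obtain U V \<kappa> where UV: "open U" "a0 \<in> U" "open V" "b0 \<in> V" "\<kappa> > 0"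
      and sub: "\<And>a a'. a \<in> U \<Longrightarrow> a' \<in> U \<Longrightarrow> S a \<inter> V \<subseteq> S a' + (*\<^sub>R) (\<kappa> * norm (a' - a)) ` cball 0 1"
      by blast
    obtain s1 s2 where s: "s1 > 0" "ball a0 s1 \<subseteq> U" "s2 > 0" "ball b0 s2 \<subseteq> V"
      using UV openE by metis
    have "?P (min s1 s2) \<kappa>"
    proof (intro ballI)
      fix a a' b
      assume "a \<in> ball a0 (min s1 s2)" "a' \<in> ball a0 (min s1 s2)" "b \<in> S a \<inter> ball b0 (min s1 s2)"
      then have "a \<in> U" "a' \<in> U" "b \<in> S a \<inter> V"
        using s by auto
      then have "b \<in> S a' + (*\<^sub>R) (\<kappa> * norm (a' - a)) ` cball 0 1"
        using sub by blast
      then show "\<exists>b'\<in>S a'. norm (b - b') \<le> \<kappa> * norm (a' - a)"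
        using \<open>\<kappa> > 0\<close> by (subst (asm) mem_plus_scaled_cball) auto
    qed
    then show ?R
      using s UV(5) by (metis min_less_iff_conj)
  next
    assume ?R
    then obtain s \<kappa> where s: "s > 0" "\<kappa> > 0" "?P s \<kappa>" by blast
    have "S a \<inter> ball b0 s \<subseteq> S a' + (*\<^sub>R) (\<kappa> * norm (a' - a)) ` cball 0 1"
      if "a \<in> ball a0 s" "a' \<in> ball a0 s" for a a'
      using s that by (auto simp: mem_plus_scaled_cball)
    then show ?L
      using s by (intro exI[of _ "ball a0 s"] exI[of _ "ball b0 s"] exI[of _ \<kappa>]) auto
  qed
  with True show ?thesis
    by (simp add: aubin_property_def)
qed (simp add: aubin_property_def)

section \<open>Normals to graphs of product mappings\<close>

lemma norm_fst_snd_pair_le: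
  "norm (x, m) \<le> norm ((x, y), (m, n))" "norm (y, n) \<le> norm ((x, y), (m, n))"
  by (auto simp: norm_Pair intro!: real_sqrt_le_mono)

text \<open>Up to regrouping coordinates the graph is the product of the two graphs. Test points
  that move in one factor only give the forward direction; conversely the two inner products add,
  each with tolerance \<epsilon> / 2, since component norms do not exceed the norm of the
  whole.\<close>

lemma regular_normal_cone_gph_Times:
  "((a, b), (c, d)) \<in> regular_normal_cone (gph (\<lambda>z. S (fst z) \<times> T (snd z))) ((x, y), (m, n)) \<longleftrightarrow>
     (a, c) \<in> regular_normal_cone (gph S) (x, m) \<and> (b, d) \<in> regular_normal_cone (gph T) (y, n)"
  (is "?l \<in> regular_normal_cone ?P ?q \<longleftrightarrow> _")
proof
  have mem: "((x', y'), (m', n')) \<in> ?P \<longleftrightarrow> (x', m') \<in> gph S \<and> (y', n') \<in> gph T" for x' y' m' n'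
    by (auto simp: gph_def)
  {
    assume L: "?l \<in> regular_normal_cone ?P ?q"
    then have q: "(x, m) \<in> gph S" "(y, n) \<in> gph T"
      using regular_normal_cone_subset mem by blast+
    show "(a, c) \<in> regular_normal_cone (gph S) (x, m) \<and> (b, d) \<in> regular_normal_cone (gph T) (y, n)"
      unfolding regular_normal_cone_iff
    proof (intro conjI q allI impI)
      fix \<epsilon> :: real assume "\<epsilon> > 0"
      with L obtain \<delta> where \<delta>: "\<delta> > 0"
        "\<And>z. z \<in> ?P \<Longrightarrow> norm (z - ?q) < \<delta> \<Longrightarrow> ?l \<bullet> (z - ?q) \<le> \<epsilon> * norm (z - ?q)"
        unfolding regular_normal_cone_iff by blast
      have "(a, c) \<bullet> (z - (x, m)) \<le> \<epsilon> * norm (z - (x, m))"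
        if "z \<in> gph S" "norm (z - (x, m)) < \<delta>" for z
        \<comment> \<open>The second factor is frozen at (y, n), so inner product and norm reduce to
          those of the first factor.\<close>
        using \<delta>(2)[of "((fst z, y), (snd z, n))"] that q(2)
        by (cases z) (simp add: mem norm_Pair)
      with \<delta>(1) show "\<exists>\<delta>>0. \<forall>z\<in>gph S. norm (z - (x, m)) < \<delta> \<longrightarrow> (a, c) \<bullet> (z - (x, m)) \<le> \<epsilon> * norm (z - (x, m))"
        by blast
      have "(b, d) \<bullet> (z - (y, n)) \<le> \<epsilon> * norm (z - (y, n))"
        if "z \<in> gph T" "norm (z - (y, n)) < \<delta>" for z
        using \<delta>(2)[of "((x, fst z), (m, snd z))"] that q(1)
        by (cases z) (simp add: mem norm_Pair)
      with \<delta>(1) show "\<exists>\<delta>>0. \<forall>z\<in>gph T. norm (z - (y, n)) < \<delta> \<longrightarrow> (b, d) \<bullet> (z - (y, n)) \<le> \<epsilon> * norm (z - (y, n))"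
        by blast
    qed
  next
    assume R: "(a, c) \<in> regular_normal_cone (gph S) (x, m) \<and> (b, d) \<in> regular_normal_cone (gph T) (y, n)"
    then have q: "(x, m) \<in> gph S" "(y, n) \<in> gph T"
      using regular_normal_cone_subset by blast+
    show "?l \<in> regular_normal_cone ?P ?q"
      unfolding regular_normal_cone_iff
    proof (intro conjI allI impI)
      show "?q \<in> ?P" using q mem by blast
      fix \<epsilon> :: real assume "\<epsilon> > 0"
      then have \<epsilon>: "\<epsilon> / 2 > 0" by simp
      with R obtain \<delta>1 where \<delta>1: "\<delta>1 > 0" "\<And>z. z \<in> gph S \<Longrightarrow> norm (z - (x, m)) < \<delta>1 \<Longrightarrow>
          (a, c) \<bullet> (z - (x, m)) \<le> \<epsilon> / 2 * norm (z - (x, m))"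
        unfolding regular_normal_cone_iff by meson
      from \<epsilon> R obtain \<delta>2 where \<delta>2: "\<delta>2 > 0" "\<And>z. z \<in> gph T \<Longrightarrow> norm (z - (y, n)) < \<delta>2 \<Longrightarrow>
          (b, d) \<bullet> (z - (y, n)) \<le> \<epsilon> / 2 * norm (z - (y, n))"
        unfolding regular_normal_cone_iff by meson
      have "?l \<bullet> (z - ?q) \<le> \<epsilon> * norm (z - ?q)" if z: "z \<in> ?P" "norm (z - ?q) < min \<delta>1 \<delta>2" for z
      proof -
        obtain x' y' m' n' where z': "z = ((x', y'), (m', n'))"
          by (metis prod.collapse)
        let ?s = "(x', m') - (x, m)" and ?t = "(y', n') - (y, n)"
        have n: "norm ?s \<le> norm (z - ?q)" "norm ?t \<le> norm (z - ?q)"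
          unfolding z' diff_Pair by (rule norm_fst_snd_pair_le)+
        have "?l \<bullet> (z - ?q) = (a, c) \<bullet> ?s + (b, d) \<bullet> ?t"
          by (simp add: z')
        also have "(a, c) \<bullet> ?s \<le> \<epsilon> / 2 * norm ?s"
          using z n mem by (intro \<delta>1(2)) (auto simp: z')
        also have "\<dots> \<le> \<epsilon> / 2 * norm (z - ?q)"
          using n \<epsilon> by (intro mult_left_mono) auto
        also have "(b, d) \<bullet> ?t \<le> \<epsilon> / 2 * norm ?t"
          using z n mem by (intro \<delta>2(2)) (auto simp: z')
        also have "\<dots> \<le> \<epsilon> / 2 * norm (z - ?q)"
          using n \<epsilon> by (intro mult_left_mono) auto
        finally show ?thesis by simp
      qed
      then show "\<exists>\<delta>>0. \<forall>z\<in>?P. norm (z - ?q) < \<delta> \<longrightarrow> ?l \<bullet> (z - ?q) \<le> \<epsilon> * norm (z - ?q)"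
        using \<delta>1(1) \<delta>2(1) by (intro exI[of _ "min \<delta>1 \<delta>2"] conjI ballI impI) simp_all
    qed
  }
qed

text \<open>The product rule for regular normals holds at every point of the approximating
  sequences. Sequences for the two factors are indexed by k alike, so they can be merged term by
  term. This separates the final criterion into one coderivative condition for X and one for the
  polar cone.\<close>

lemma limiting_normal_cone_gph_Times:
  "((a, b), (c, d)) \<in> limiting_normal_cone (gph (\<lambda>z. S (fst z) \<times> T (snd z))) ((x, y), (m, n)) \<longleftrightarrow>
     (a, c) \<in> limiting_normal_cone (gph S) (x, m) \<and> (b, d) \<in> limiting_normal_cone (gph T) (y, n)"
  (is "?l \<in> limiting_normal_cone ?P ?q \<longleftrightarrow> _")
proof
  assume "?l \<in> limiting_normal_cone ?P ?q"
  then obtain z u where q: "?q \<in> ?P" and u: "\<And>k. u k \<in> regular_normal_cone ?P (z k)"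
    and lim: "z \<longlonglongrightarrow> ?q" "u \<longlonglongrightarrow> ?l"
    by (rule limiting_normal_coneE) blast
  have u': "(fst (fst (u k)), fst (snd (u k))) \<in> regular_normal_cone (gph S) (fst (fst (z k)), fst (snd (z k)))"
      "(snd (fst (u k)), snd (snd (u k))) \<in> regular_normal_cone (gph T) (snd (fst (z k)), snd (snd (z k)))" for k
    using u[of k] regular_normal_cone_gph_Times[where S = S and T = T, of "fst (fst (u k))" "snd (fst (u k))" "fst (snd (u k))"
        "snd (snd (u k))" "fst (fst (z k))" "snd (fst (z k))" "fst (snd (z k))" "snd (snd (z k))"]
    by simp_all
  note comp = tendsto_fst[OF tendsto_fst] tendsto_snd[OF tendsto_fst] tendsto_fst[OF tendsto_snd] tendsto_snd[OF tendsto_snd]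
  have "(\<lambda>k. (fst (fst (z k)), fst (snd (z k)))) \<longlonglongrightarrow> (x, m)" "(\<lambda>k. (snd (fst (z k)), snd (snd (z k)))) \<longlonglongrightarrow> (y, n)"
    "(\<lambda>k. (fst (fst (u k)), fst (snd (u k)))) \<longlonglongrightarrow> (a, c)" "(\<lambda>k. (snd (fst (u k)), snd (snd (u k)))) \<longlonglongrightarrow> (b, d)"
    using comp[OF lim(1)] comp[OF lim(2)] by (auto intro!: tendsto_Pair)
  moreover have "(x, m) \<in> gph S" "(y, n) \<in> gph T"
    using q by (auto simp: gph_def)
  ultimately show "(a, c) \<in> limiting_normal_cone (gph S) (x, m) \<and> (b, d) \<in> limiting_normal_cone (gph T) (y, n)"
    by (intro conjI limiting_normal_coneI[where C = "gph S" and u = "\<lambda>k. (fst (fst (u k)), fst (snd (u k)))", OF _ u'(1)]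
        limiting_normal_coneI[where C = "gph T" and u = "\<lambda>k. (snd (fst (u k)), snd (snd (u k)))", OF _ u'(2)])
next
  assume R: "(a, c) \<in> limiting_normal_cone (gph S) (x, m) \<and> (b, d) \<in> limiting_normal_cone (gph T) (y, n)"
  from R obtain z1 u1 where 1: "(x, m) \<in> gph S" "\<And>k. u1 k \<in> regular_normal_cone (gph S) (z1 k)"
      "z1 \<longlonglongrightarrow> (x, m)" "u1 \<longlonglongrightarrow> (a, c)"
    by (elim conjE limiting_normal_coneE) blast
  from R obtain z2 u2 where 2: "(y, n) \<in> gph T" "\<And>k. u2 k \<in> regular_normal_cone (gph T) (z2 k)"
      "z2 \<longlonglongrightarrow> (y, n)" "u2 \<longlonglongrightarrow> (b, d)"
    by (elim conjE limiting_normal_coneE) blast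
  define merge :: "'a \<times> 'c \<Rightarrow> 'b \<times> 'd \<Rightarrow> ('a \<times> 'b) \<times> 'c \<times> 'd" where
    "merge p q = ((fst p, fst q), (snd p, snd q))" for p q
  have reg: "merge (u1 k) (u2 k) \<in> regular_normal_cone ?P (merge (z1 k) (z2 k))" for k
    unfolding merge_def regular_normal_cone_gph_Times using 1(2) 2(2) by simp
  have lim: "(\<lambda>k. merge (p k) (q k)) \<longlonglongrightarrow> merge p0 q0" if "p \<longlonglongrightarrow> p0" "q \<longlonglongrightarrow> q0" for p q p0 q0
    unfolding merge_def by (intro tendsto_intros that)
  have "merge (a, c) (b, d) \<in> limiting_normal_cone ?P (merge (x, m) (y, n))"
    using 1(1) 2(1) by (intro limiting_normal_coneI[OF _ reg lim[OF 1(3) 2(3)] lim[OF 1(4) 2(4)]])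
      (auto simp: merge_def gph_def)
  then show "?l \<in> limiting_normal_cone ?P ?q"
    by (simp add: merge_def)
qed

text \<open>For a fixed z the inequality v \<bullet> (z - x) \<le> 0 is a closed condition on the
  pair (x, v), and the graph is cut out by these conditions together with x in C.\<close>

lemma closed_gph_normal_cone:
  fixes C :: "'a::real_inner set"
  assumes "closed C"
  shows "closed (gph (normal_cone C))"
proof -
  have "gph (normal_cone C) = (C \<times> UNIV) \<inter> (\<Inter>z\<in>C. {p. snd p \<bullet> (z - fst p) \<le> 0})"
    by (auto simp: gph_def normal_cone_def split: if_splits)
  also have "closed \<dots>"
    using assms by (intro closed_Int closed_Times closed_UNIV closed_INT ballI closed_Collect_le continuous_intros)
  finally show ?thesis .
qed

lemma closed_gph_Times:
  assumes "closed (gph S)" "closed (gph T)"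
  shows "closed (gph (\<lambda>z. S (fst z) \<times> T (snd z)))"
proof -
  have "gph (\<lambda>z. S (fst z) \<times> T (snd z))
      = (\<lambda>p. (fst (fst p), fst (snd p))) -` gph S \<inter> (\<lambda>p. (snd (fst p), snd (snd p))) -` gph T"
    by (auto simp: gph_def)
  also have "closed \<dots>"
    by (intro closed_Int closed_vimage assms continuous_intros)
  finally show ?thesis .
qed

lemma closed_polar: "closed (polar K)"
proof -
  have "polar K = (\<Inter>k\<in>K. {y. y \<bullet> k \<le> 0})"
    by (auto simp: polar_def)
  then show ?thesis
    by (auto intro!: closed_INT closed_Collect_le continuous_intros)
qed

text \<open>A surjective isometry of the parameter space carries balls around a0 onto balls around
  its image and preserves parameter distances. It serves to change the sign of the constraint
  perturbation.\<close>

lemma aubin_property_isometry: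
  assumes "\<And>a b. norm (\<phi> a - \<phi> b) = norm (a - b)" "surj \<phi>"
  shows "aubin_property S (\<phi> a0) b0 \<longleftrightarrow> aubin_property (\<lambda>a. S (\<phi> a)) a0 b0"
proof -
  have ball: "ball (\<phi> a0) s = \<phi> ` ball a0 s" for s
  proof (intro set_eqI iffI)
    fix y assume "y \<in> ball (\<phi> a0) s"
    moreover obtain x where "y = \<phi> x"
      using assms(2) by (rule surjE)
    ultimately show "y \<in> \<phi> ` ball a0 s"
      by (simp add: dist_norm assms(1))
  qed (auto simp: dist_norm assms(1))
  show ?thesis
    unfolding aubin_property_iff ball by (simp add: assms(1))
qed


section \<open>Parametrized generalized equations\<close>

text \<open>The parameter is a pair (w, r) in which r acts as a translation. The equation is tied to
  S only on the open set \<open>\<Omega>\<close>, because differentiability of H is available only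
  locally. The map A is the partial derivative in z at the base point.\<close>

locale generalized_equation =
  fixes M :: "'z::euclidean_space \<Rightarrow> 'z set"
    and H :: "'z \<times> 'w::real_normed_vector \<Rightarrow> 'z"
    and S :: "'w \<times> 'z \<Rightarrow> 'z set"
    and \<Omega> :: "('z \<times> 'w) set"
    and zb :: 'z and wb :: 'w and rb :: 'z and A :: "'z \<Rightarrow> 'z"
  assumes closed_gph: "closed (gph M)"
    and open_\<Omega>: "open \<Omega>" and base: "(zb, wb) \<in> \<Omega>"
    and S_iff: "\<And>z w r. (z, w) \<in> \<Omega> \<Longrightarrow> z \<in> S (w, r) \<longleftrightarrow> r - H (z, w) \<in> M z"
    and strict_H: "\<And>q. q \<in> \<Omega> \<Longrightarrow> strictly_differentiable H q"
    and sol: "zb \<in> S (wb, rb)"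
    and deriv_A: "((\<lambda>z. H (z, wb)) has_derivative A) (at zb)"
begin

abbreviation mb :: 'z where "mb \<equiv> rb - H (zb, wb)"

lemma base_mem: "(zb, mb) \<in> gph M"
  using sol S_iff[OF base] by (simp add: gph_def)

lemma linear_A: "linear A"
  using deriv_A by (rule has_derivative_linear)

lemma strict_H_base:
  obtains D where "has_strict_derivative H D (zb, wb)" "\<And>h. D (h, 0) = A h"
proof -
  obtain D where D: "has_strict_derivative H D (zb, wb)"
    using strict_H[OF base] unfolding strictly_differentiable_iff by blast
  then have "((\<lambda>z. H (z, wb)) has_derivative (\<lambda>h. D (h, 0))) (at zb)"
    by (intro has_derivative_at_slice has_strict_derivative_imp_has_derivative)
  with deriv_A have "A = (\<lambda>h. D (h, 0))"
    by (rule has_derivative_unique)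
  with D show thesis
    by (intro that[of D]) auto
qed

text \<open>For two points sharing the same w, the increment has no w-component, so the full strict
  derivative acts through A alone. The estimate is uniform in w near the base value, which is what
  allows perturbed w later.\<close>

lemma strict_H_A:
  assumes "\<epsilon> > 0"
  obtains \<delta> where "\<delta> > 0"
    "\<And>z z' w. (z, w) \<in> ball (zb, wb) \<delta> \<Longrightarrow> (z', w) \<in> ball (zb, wb) \<delta> \<Longrightarrow>
       norm (H (z, w) - H (z', w) - A (z - z')) \<le> \<epsilon> * norm (z - z')"
proof -
  obtain D where D: "has_strict_derivative H D (zb, wb)" "\<And>h. D (h, 0) = A h"
    using strict_H_base by blast
  obtain \<delta> where \<delta>: "\<delta> > 0" "\<And>a b. a \<in> ball (zb, wb) \<delta> \<Longrightarrow> b \<in> ball (zb, wb) \<delta> \<Longrightarrow>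
      norm (H a - H b - D (a - b)) \<le> \<epsilon> * norm (a - b)"
    using D(1) assms by (rule has_strict_derivativeD) blast
  show thesis
  proof (rule that[OF \<delta>(1)])
    fix z z' w
    assume "(z, w) \<in> ball (zb, wb) \<delta>" "(z', w) \<in> ball (zb, wb) \<delta>"
    from \<delta>(2)[OF this] show "norm (H (z, w) - H (z', w) - A (z - z')) \<le> \<epsilon> * norm (z - z')"
      by (simp add: D(2) norm_Pair)
  qed
qed

section \<open>Necessity of the coderivative criterion\<close>

text \<open>Moving r by t in the direction of \<beta> forces a solution z' with |z' - z| \<le>
  \<kappa> t, and the corresponding graph point tests the normal. The component along \<beta> gains
  t |\<beta>|, while the linear part of H turns \<alpha> into \<alpha> - A* \<beta>; division by t
  gives the bound. The last term pays for linearizing H.\<close>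

lemma aubin_imp_regular_normal_bound:
  assumes aubin: "\<forall>a\<in>ball (wb, rb) s. \<forall>a'\<in>ball (wb, rb) s. \<forall>b\<in>S a \<inter> ball zb s.
      \<exists>b'\<in>S a'. norm (b - b') \<le> \<kappa> * norm (a' - a)"
    and pos: "s > 0" "\<kappa> > 0" "\<epsilon> > 0"
  obtains \<eta> where "\<eta> > 0"
    "\<And>z m \<alpha> \<beta>. norm (z - zb) < \<eta> \<Longrightarrow> norm (m - mb) < \<eta> \<Longrightarrow>
      (\<alpha>, \<beta>) \<in> regular_normal_cone (gph M) (z, m) \<Longrightarrow>
      norm \<beta> \<le> \<kappa> * norm (\<alpha> - adjoint A \<beta>) + \<epsilon> * \<kappa> * norm \<beta>"
proof -
  obtain D where D: "has_strict_derivative H D (zb, wb)"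
    using strict_H_base by blast
  obtain \<delta>1 where \<delta>1: "\<delta>1 > 0"
    "\<And>z z' w. (z, w) \<in> ball (zb, wb) \<delta>1 \<Longrightarrow> (z', w) \<in> ball (zb, wb) \<delta>1 \<Longrightarrow>
       norm (H (z, w) - H (z', w) - A (z - z')) \<le> \<epsilon> * norm (z - z')"
    using pos(3) by (rule strict_H_A) blast
  obtain \<delta>2 L where L: "\<delta>2 > 0" "L > 0"
    "\<And>a b. a \<in> ball (zb, wb) \<delta>2 \<Longrightarrow> b \<in> ball (zb, wb) \<delta>2 \<Longrightarrow> norm (H a - H b) \<le> L * norm (a - b)"
    using D by (rule has_strict_derivative_local_lipschitz) blast
  obtain \<delta>3 where \<delta>3: "\<delta>3 > 0" "ball (zb, wb) \<delta>3 \<subseteq> \<Omega>"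
    using open_\<Omega> base openE by blast
  define \<delta> where "\<delta> = min (min \<delta>1 \<delta>2) \<delta>3"
  have \<delta>: "\<delta> > 0" "\<delta> \<le> \<delta>1" "\<delta> \<le> \<delta>2" "\<delta> \<le> \<delta>3"
    using \<delta>1 L \<delta>3 by (auto simp: \<delta>_def)
  have ball: "(z, wb) \<in> ball (zb, wb) d \<longleftrightarrow> norm (z - zb) < d" for z d
    by (simp add: dist_Pair_Pair dist_norm norm_minus_commute)
  have in_\<Omega>: "(z, wb) \<in> \<Omega>" if "norm (z - zb) < \<delta>" for z
  proof -
    have "(z, wb) \<in> ball (zb, wb) \<delta>3" unfolding ball using that \<delta>(4) by linarith
    with \<delta>3(2) show ?thesis by blast
  qed
  have lip: "norm (H (z, wb) - H (z', wb)) \<le> L * norm (z - z')"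
    and approx: "norm (H (z, wb) - H (z', wb) - A (z - z')) \<le> \<epsilon> * norm (z - z')"
    if "norm (z - zb) < \<delta>" "norm (z' - zb) < \<delta>" for z z'
  proof -
    have "(z, wb) \<in> ball (zb, wb) d" "(z', wb) \<in> ball (zb, wb) d" if "\<delta> \<le> d" for d
      unfolding ball using that \<open>norm (z - zb) < \<delta>\<close> \<open>norm (z' - zb) < \<delta>\<close> by linarith+
    then show "norm (H (z, wb) - H (z', wb)) \<le> L * norm (z - z')"
      "norm (H (z, wb) - H (z', wb) - A (z - z')) \<le> \<epsilon> * norm (z - z')"
      using L(3)[of "(z, wb)" "(z', wb)"] \<delta>1(2)[of z wb z'] \<delta> by (simp_all add: norm_Pair del: mem_ball)
  qed
  \<comment> \<open>The first bound leaves room for z' inside the radius \<delta>; the second puts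
    the parameter r belonging to (z, m) within s / 2 of \<open>rb\<close>.\<close>
  define \<eta> where "\<eta> = min (\<delta> / 2) (s / (2 * (1 + L)))"
  have \<eta>: "\<eta> > 0" "\<eta> \<le> \<delta> / 2" "\<eta> * (1 + L) \<le> s / 2" "\<eta> \<le> s / 2"
  proof -
    show "\<eta> > 0" using \<delta>(1) L(2) pos(1) by (simp add: \<eta>_def)
    show "\<eta> \<le> \<delta> / 2" unfolding \<eta>_def by (rule min.cobounded1)
    have "\<eta> \<le> s / (2 * (1 + L))" by (simp add: \<eta>_def)
    then show *: "\<eta> * (1 + L) \<le> s / 2" using L(2) by (simp add: field_simps)
    have "\<eta> \<le> \<eta> * (1 + L)" using \<open>\<eta> > 0\<close> L(2) by simp
    with * show "\<eta> \<le> s / 2" by linarith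
  qed
  have "norm \<beta> \<le> \<kappa> * norm (\<alpha> - adjoint A \<beta>) + \<epsilon> * \<kappa> * norm \<beta>"
    if z: "norm (z - zb) < \<eta>" and m: "norm (m - mb) < \<eta>"
      and normal: "(\<alpha>, \<beta>) \<in> regular_normal_cone (gph M) (z, m)" for z m \<alpha> \<beta>
  proof (cases "\<beta> = 0")
    case True
    then show ?thesis using pos by simp
  next
    case False
    define e where "e = \<beta> /\<^sub>R norm \<beta>"
    have e: "norm e = 1" "\<beta> \<bullet> e = norm \<beta>"
      using False by (auto simp: e_def power2_norm_eq_inner[symmetric] power2_eq_square)
    \<comment> \<open>This is the translation for which z is a solution with graph element m; w
      stays at its base value throughout.\<close>
    define r where "r = m + H (z, wb)"
    have zm: "m \<in> M z" using normal regular_normal_cone_subset by (force simp: gph_def)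
    have z\<delta>: "norm (z - zb) < \<delta>" using z \<eta> \<delta>(1) by linarith
    have "(z, wb) \<in> \<Omega>" using z\<delta> by (rule in_\<Omega>)
    then have zS: "z \<in> S (wb, r)" using zm S_iff by (simp add: r_def)
    have "norm (r - rb) \<le> norm (m - mb) + norm (H (z, wb) - H (zb, wb))"
      using norm_triangle_ineq[of "m - mb" "H (z, wb) - H (zb, wb)"] by (simp add: r_def algebra_simps)
    also have "norm (H (z, wb) - H (zb, wb)) \<le> L * norm (z - zb)"
      using lip[OF z\<delta>, of zb] \<delta>(1) by simp
    also have "norm (m - mb) + L * norm (z - zb) < \<eta> + L * \<eta>"
      using m z L(2) by (intro add_less_le_mono mult_left_mono) auto
    finally have r: "norm (r - rb) < s / 2"
      using \<eta>(3) by (simp add: algebra_simps)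
    \<comment> \<open>C t will bound the distance of the test point from (z, m): \<kappa> t in the
      first component and t + L \<kappa> t in the second.\<close>
    define C where "C = \<kappa> + (1 + L * \<kappa>)"
    have C: "C > 0" using pos L by (simp add: C_def add_pos_pos)
    have key: "norm \<beta> \<le> \<kappa> * norm (\<alpha> - adjoint A \<beta>) + \<epsilon> * \<kappa> * norm \<beta> + \<epsilon>' * C" if "\<epsilon>' > 0" for \<epsilon>'
    proof -
      obtain d where d: "d > 0" "\<And>q. q \<in> gph M \<Longrightarrow> norm (q - (z, m)) < d \<Longrightarrow>
          (\<alpha>, \<beta>) \<bullet> (q - (z, m)) \<le> \<epsilon>' * norm (q - (z, m))"
        using normal \<open>\<epsilon>' > 0\<close> unfolding regular_normal_cone_iff by blast
      \<comment> \<open>The three bounds keep r' in the Aubin neighborhood, z' where H is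
        approximated by A, and the test point within the radius d of the normal inequality.\<close>
      define t where "t = min (s / 4) (min (\<delta> / (4 * \<kappa>)) (d / (2 * C)))"
      have t: "t > 0" "t \<le> s / 4" "\<kappa> * t \<le> \<delta> / 4" "C * t < d"
      proof -
        show "t > 0" using pos \<delta>(1) d(1) C by (simp add: t_def)
        show "t \<le> s / 4" unfolding t_def by (rule min.cobounded1)
        have "t \<le> \<delta> / (4 * \<kappa>)" "t \<le> d / (2 * C)" by (auto simp: t_def)
        then have "\<kappa> * t \<le> \<delta> / 4" "C * t \<le> d / 2"
          using pos C by (auto simp: field_simps)
        then show "\<kappa> * t \<le> \<delta> / 4" "C * t < d" using d(1) by auto
      qed
      define r' where "r' = r + t *\<^sub>R e"
      have r': "norm (r' - r) = t" using t e by (simp add: r'_def)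
      have "norm (r' - rb) < s"
        using norm_triangle_ineq[of "r - rb" "r' - r"] r r' t(2) pos(1) by simp
      then have mem: "(wb, r) \<in> ball (wb, rb) s" "(wb, r') \<in> ball (wb, rb) s" "z \<in> S (wb, r) \<inter> ball zb s"
        using r zS z \<eta>(4) pos(1) by (auto simp: dist_Pair_Pair dist_norm norm_minus_commute)
      then obtain z' where z': "z' \<in> S (wb, r')" "norm (z - z') \<le> \<kappa> * norm ((wb, r') - (wb, r))"
        using aubin by blast
      then have zz': "norm (z' - z) \<le> \<kappa> * t"
        using t(1) by (simp add: norm_Pair r' norm_minus_commute)
      have z'\<delta>: "norm (z' - zb) < \<delta>"
        using norm_triangle_ineq[of "z' - z" "z - zb"] zz' t(3) z \<eta>(2) \<delta>(1) by simp
      define m' where "m' = r' - H (z', wb)"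
      have "(z', wb) \<in> \<Omega>" using z'\<delta> by (rule in_\<Omega>)
      then have gph: "(z', m') \<in> gph M" using z' S_iff by (simp add: m'_def gph_def)
      define \<rho> where "\<rho> = H (z', wb) - H (z, wb) - A (z' - z)"
      have "norm \<rho> \<le> \<epsilon> * norm (z' - z)"
        unfolding \<rho>_def using z'\<delta> z\<delta> by (rule approx)
      also have "\<dots> \<le> \<epsilon> * (\<kappa> * t)"
        using zz' pos(3) by (intro mult_left_mono) auto
      finally have \<rho>: "norm \<rho> \<le> \<epsilon> * (\<kappa> * t)" .
      have mm': "m' - m = t *\<^sub>R e - A (z' - z) - \<rho>"
        by (simp add: m'_def \<rho>_def r'_def r_def)
      have "norm (H (z', wb) - H (z, wb)) \<le> L * norm (z' - z)"
        using z'\<delta> z\<delta> by (rule lip)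
      also have "\<dots> \<le> L * (\<kappa> * t)"
        using zz' L by (intro mult_left_mono) auto
      finally have "norm (m' - m) \<le> t + L * (\<kappa> * t)"
        using norm_triangle_ineq4[of "t *\<^sub>R e" "H (z', wb) - H (z, wb)"] e t(1)
        by (simp add: m'_def r'_def r_def algebra_simps)
      then have near: "norm ((z', m') - (z, m)) \<le> C * t"
        using norm_Pair_le[of "z' - z" "m' - m"] zz' by (simp add: C_def algebra_simps)
      have "(\<alpha>, \<beta>) \<bullet> ((z', m') - (z, m)) \<le> \<epsilon>' * norm ((z', m') - (z, m))"
        using d(2)[OF gph] near t(4) by linarith
      also have "\<dots> \<le> \<epsilon>' * (C * t)"
        using near \<open>\<epsilon>' > 0\<close> by (intro mult_left_mono) auto
      finally have "\<alpha> \<bullet> (z' - z) + \<beta> \<bullet> (m' - m) \<le> \<epsilon>' * (C * t)"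
        by simp
      moreover have "\<beta> \<bullet> (m' - m) = t * norm \<beta> - adjoint A \<beta> \<bullet> (z' - z) - \<beta> \<bullet> \<rho>"
        using e by (simp add: mm' inner_diff_right adjoint_works[OF linear_A] inner_commute)
      ultimately have "t * norm \<beta> \<le> - ((\<alpha> - adjoint A \<beta>) \<bullet> (z' - z)) + \<beta> \<bullet> \<rho> + \<epsilon>' * (C * t)"
        by (simp add: inner_diff_left)
      also have "- ((\<alpha> - adjoint A \<beta>) \<bullet> (z' - z)) \<le> norm (\<alpha> - adjoint A \<beta>) * norm (z' - z)"
        using Cauchy_Schwarz_ineq2[of "\<alpha> - adjoint A \<beta>" "z' - z"] by linarith
      also have "\<dots> \<le> norm (\<alpha> - adjoint A \<beta>) * (\<kappa> * t)"
        using zz' by (intro mult_left_mono) auto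
      also have "\<beta> \<bullet> \<rho> \<le> norm \<beta> * norm \<rho>"
        by (rule norm_cauchy_schwarz)
      also have "\<dots> \<le> norm \<beta> * (\<epsilon> * (\<kappa> * t))"
        using \<rho> by (intro mult_left_mono) auto
      finally have "t * norm \<beta> \<le> t * (\<kappa> * norm (\<alpha> - adjoint A \<beta>) + \<epsilon> * \<kappa> * norm \<beta> + \<epsilon>' * C)"
        by (simp add: algebra_simps)
      then show ?thesis using t(1) by simp
    qed
    show ?thesis
    \<comment> \<open>The tolerance of the regular normal enters only through \<epsilon>' C with C
      fixed, so it can be sent to zero.\<close>
    proof (rule field_le_epsilon)
      fix e' :: real assume "e' > 0"
      then show "norm \<beta> \<le> \<kappa> * norm (\<alpha> - adjoint A \<beta>) + \<epsilon> * \<kappa> * norm \<beta> + e'"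
        using key[of "e' / C"] C by simp
    qed
  qed
  with \<eta>(1) show thesis
    by (rule that)
qed

lemma aubin_imp_coderivative_criterion:
  assumes "aubin_property S (wb, rb) zb"
    and normal: "(adjoint A \<zeta>, \<zeta>) \<in> limiting_normal_cone (gph M) (zb, mb)"
  shows "\<zeta> = 0"
proof -
  obtain s \<kappa> where s: "s > 0" "\<kappa> > 0" and aubin:
    "\<forall>a\<in>ball (wb, rb) s. \<forall>a'\<in>ball (wb, rb) s. \<forall>b\<in>S a \<inter> ball zb s.
      \<exists>b'\<in>S a'. norm (b - b') \<le> \<kappa> * norm (a' - a)"
    using assms(1) unfolding aubin_property_iff by (elim conjE exE) (rule that)
  \<comment> \<open>With this tolerance the linearization term is half of |\<beta>|. Along normals
    converging to (A* \<zeta>, \<zeta>) the other term tends to zero, leaving |\<zeta>| \<le>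
    |\<zeta>| / 2.\<close>
  have "1 / (2 * \<kappa>) > 0" using s by simp
  with aubin s obtain \<eta> where \<eta>: "\<eta> > 0"
    "\<And>z m \<alpha> \<beta>. norm (z - zb) < \<eta> \<Longrightarrow> norm (m - mb) < \<eta> \<Longrightarrow>
      (\<alpha>, \<beta>) \<in> regular_normal_cone (gph M) (z, m) \<Longrightarrow>
      norm \<beta> \<le> \<kappa> * norm (\<alpha> - adjoint A \<beta>) + 1 / (2 * \<kappa>) * \<kappa> * norm \<beta>"
    by (rule aubin_imp_regular_normal_bound) blast
  obtain q v where q: "\<And>k. v k \<in> regular_normal_cone (gph M) (q k)"
      "q \<longlonglongrightarrow> (zb, mb)" "v \<longlonglongrightarrow> (adjoint A \<zeta>, \<zeta>)"
    using normal by (rule limiting_normal_coneE) blast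
  have bl: "bounded_linear (adjoint A)"
    using adjoint_linear[OF linear_A] by (simp add: linear_conv_bounded_linear)
  have q': "(\<lambda>k. fst (q k)) \<longlonglongrightarrow> zb" "(\<lambda>k. snd (q k)) \<longlonglongrightarrow> mb"
    and v': "(\<lambda>k. fst (v k)) \<longlonglongrightarrow> adjoint A \<zeta>" "(\<lambda>k. snd (v k)) \<longlonglongrightarrow> \<zeta>"
    using tendsto_fst[OF q(2)] tendsto_snd[OF q(2)] tendsto_fst[OF q(3)] tendsto_snd[OF q(3)] by auto
  have "\<forall>\<^sub>F k in sequentially. norm (fst (q k) - zb) < \<eta>" "\<forall>\<^sub>F k in sequentially. norm (snd (q k) - mb) < \<eta>"
    using tendstoD[OF q'(1) \<eta>(1)] tendstoD[OF q'(2) \<eta>(1)] by (simp_all add: dist_norm)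
  then have "\<forall>\<^sub>F k in sequentially. norm (snd (v k))
      \<le> \<kappa> * norm (fst (v k) - adjoint A (snd (v k))) + 1 / (2 * \<kappa>) * \<kappa> * norm (snd (v k))"
  proof eventually_elim
    case (elim k)
    with \<eta>(2)[of "fst (q k)" "snd (q k)" "fst (v k)" "snd (v k)"] q(1)[of k]
    show ?case by (simp only: prod.collapse)
  qed
  moreover have "(\<lambda>k. \<kappa> * norm (fst (v k) - adjoint A (snd (v k))) + 1 / (2 * \<kappa>) * \<kappa> * norm (snd (v k)))
      \<longlonglongrightarrow> \<kappa> * norm (adjoint A \<zeta> - adjoint A \<zeta>) + 1 / (2 * \<kappa>) * \<kappa> * norm \<zeta>"
    by (intro tendsto_intros bounded_linear.tendsto[OF bl] v')
  ultimately have "norm \<zeta> \<le> \<kappa> * norm (adjoint A \<zeta> - adjoint A \<zeta>) + 1 / (2 * \<kappa>) * \<kappa> * norm \<zeta>"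
    using tendsto_le[OF sequentially_bot _ tendsto_norm[OF v'(2)]] by blast
  then show ?thesis
    using s by simp
qed

section \<open>Sufficiency of the coderivative criterion\<close>

text \<open>Failure of the Aubin estimate gives a solution z0 for one parameter with no solution for
  another parameter within \<kappa> times their distance. A penalized residual for the second
  parameter has a minimizer closer to z0 than that, so its residual is nonzero and the norm is
  differentiable there; Fermat's rule then gives the normal.\<close>

lemma not_aubin_imp_approximate_normal:
  assumes not_aubin: "\<not> aubin_property S (wb, rb) zb" and "\<epsilon> > 0"
  obtains z m \<alpha> \<beta> where "norm (z - zb) < \<epsilon>" "norm (m - mb) < \<epsilon>"
    "(\<alpha>, \<beta>) \<in> regular_normal_cone (gph M) (z, m)" "norm \<beta> = 1" "norm (\<alpha> - adjoint A \<beta>) \<le> \<epsilon>"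
proof -
  obtain D where D: "has_strict_derivative H D (zb, wb)"
    using strict_H_base by blast
  have "\<epsilon> / 2 > 0" using \<open>\<epsilon> > 0\<close> by simp
  then obtain \<delta>1 where \<delta>1: "\<delta>1 > 0"
    "\<And>z z' w. (z, w) \<in> ball (zb, wb) \<delta>1 \<Longrightarrow> (z', w) \<in> ball (zb, wb) \<delta>1 \<Longrightarrow>
       norm (H (z, w) - H (z', w) - A (z - z')) \<le> \<epsilon> / 2 * norm (z - z')"
    by (rule strict_H_A) blast
  obtain \<delta>2 L where L: "\<delta>2 > 0" "L > 0"
    "\<And>a b. a \<in> ball (zb, wb) \<delta>2 \<Longrightarrow> b \<in> ball (zb, wb) \<delta>2 \<Longrightarrow> norm (H a - H b) \<le> L * norm (a - b)"
    using D by (rule has_strict_derivative_local_lipschitz) blast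
  obtain \<delta>3 where \<delta>3: "\<delta>3 > 0" "ball (zb, wb) \<delta>3 \<subseteq> \<Omega>"
    using open_\<Omega> base openE by blast
  define \<delta> where "\<delta> = min (min \<delta>1 \<delta>2) \<delta>3"
  have \<delta>: "\<delta> > 0" "ball (zb, wb) \<delta> \<subseteq> ball (zb, wb) \<delta>1"
    "ball (zb, wb) \<delta> \<subseteq> ball (zb, wb) \<delta>2" "ball (zb, wb) \<delta> \<subseteq> \<Omega>"
    using \<delta>1(1) L(1) \<delta>3 by (auto simp: \<delta>_def)
  have ball: "(z, w) \<in> ball (zb, wb) \<delta>" if "norm (z - zb) < \<delta> / 2" "norm (w - wb) < \<delta> / 2" for z w
    using norm_Pair_le[of "zb - z" "wb - w"] that
    by (simp add: dist_norm norm_minus_commute)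
  have lip: "norm (H (z, w) - H (z', w')) \<le> L * (norm (z - z') + norm (w - w'))"
    if "(z, w) \<in> ball (zb, wb) \<delta>" "(z', w') \<in> ball (zb, wb) \<delta>" for z z' w w'
  proof -
    have "norm (H (z, w) - H (z', w')) \<le> L * norm ((z, w) - (z', w'))"
      by (intro L(3) subsetD[OF \<delta>(3)] that)
    also have "\<dots> \<le> L * (norm (z - z') + norm (w - w'))"
      using L(2) norm_Pair_le[of "z - z'" "w - w'"] by (intro mult_left_mono) auto
    finally show ?thesis .
  qed
  \<comment> \<open>The penalty gradient will be at most 2 c = \<epsilon> / 2; the other half of
    \<epsilon> is spent on replacing the nearby derivative of H by A. The choice of \<kappa> matches
    the confinement radius of the minimizer to the failing Aubin estimate, and s is small enough to
    keep all points within \<rho>.\<close>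
  define c where "c = \<epsilon> / 4"
  define \<kappa> where "\<kappa> = (1 + L) / c"
  define \<rho> where "\<rho> = min (\<delta> / 4) (\<epsilon> / 2)"
  define s where "s = \<rho> / (8 * (1 + L) * (1 + \<kappa>))"
  have c: "c > 0" using \<open>\<epsilon> > 0\<close> by (simp add: c_def)
  have \<kappa>: "\<kappa> > 0" using c L(2) by (simp add: \<kappa>_def)
  have \<rho>: "\<rho> > 0" "\<rho> < \<delta> / 2" "\<rho> < \<epsilon>"
    using \<delta>(1) \<open>\<epsilon> > 0\<close> by (auto simp: \<rho>_def)
  have s: "s > 0" using \<rho> L(2) \<kappa> by (simp add: s_def)
  \<comment> \<open>Expanding the definition of s bounds all the positive products at once; the
    three inequalities in \<open>s\<rho>\<close> become linear in them.\<close>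
  have "8 * (s + s * L + s * \<kappa> + s * (L * \<kappa>)) = \<rho>"
  proof -
    have "s * (8 * (1 + L) * (1 + \<kappa>)) = \<rho>"
      using L(2) \<kappa> by (simp add: s_def)
    then show ?thesis by (simp add: algebra_simps)
  qed
  moreover have "s * L > 0" "s * \<kappa> > 0" "s * (L * \<kappa>) > 0"
    using s L(2) \<kappa> by auto
  ultimately have s\<rho>: "s + 2 * (s * \<kappa>) < \<rho>" "s < \<rho>"
    "3 * s + 2 * (L * s) + L * (s + 2 * (s * \<kappa>)) + L * s < \<rho>"
    using s \<rho>(1) by (auto simp: algebra_simps)
  obtain w r w' r' z0
    where p: "(w, r) \<in> ball (wb, rb) s" and p': "(w', r') \<in> ball (wb, rb) s"
      and z0: "z0 \<in> S (w, r)" "norm (z0 - zb) < s"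
      and far: "\<And>z. z \<in> S (w', r') \<Longrightarrow> norm (z0 - z) > \<kappa> * norm ((w', r') - (w, r))"
  proof -
    let ?P = "\<forall>a\<in>ball (wb, rb) s. \<forall>a'\<in>ball (wb, rb) s. \<forall>b\<in>S a \<inter> ball zb s.
        \<exists>b'\<in>S a'. norm (b - b') \<le> \<kappa> * norm (a' - a)"
    have "\<not> ?P"
    proof
      assume ?P
      then have "aubin_property S (wb, rb) zb"
        unfolding aubin_property_iff by (intro conjI sol exI[of _ s] exI[of _ \<kappa>] s \<kappa>)
      with not_aubin show False ..
    qed
    then obtain a a' b where "a \<in> ball (wb, rb) s" "a' \<in> ball (wb, rb) s" "b \<in> S a" "b \<in> ball zb s"
      "\<And>b'. b' \<in> S a' \<Longrightarrow> \<not> norm (b - b') \<le> \<kappa> * norm (a' - a)"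
      by blast
    then show thesis
      by (intro that[of "fst a" "snd a" "fst a'" "snd a'" b])
        (auto simp: dist_norm norm_minus_commute not_le)
  qed
  have comp: "norm (v - wb) < s" "norm (t - rb) < s" if "(v, t) \<in> ball (wb, rb) s" for v t
    using that norm_fst_le[of "wb - v" "rb - t"] norm_snd_le[of "rb - t" "wb - v"]
    by (simp_all add: dist_norm norm_minus_commute)
  note w = comp[OF p] and w' = comp[OF p']
  define \<pi> where "\<pi> = norm ((w', r') - (w, r))"
  have \<pi>: "\<pi> < 2 * s" "norm (w' - w) \<le> \<pi>" "norm (r' - r) \<le> \<pi>"
  proof -
    have "dist (w', r') (w, r) < s + s"
      using p p' by (intro dist_triangle_less_add[of _ "(wb, rb)"]) (auto simp: dist_commute)
    then show "\<pi> < 2 * s" by (simp add: \<pi>_def dist_norm)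
    show "norm (w' - w) \<le> \<pi>" "norm (r' - r) \<le> \<pi>"
      unfolding \<pi>_def by (simp_all add: norm_fst_le norm_snd_le)
  qed
  \<comment> \<open>If the two parameters coincided, z0 itself would be a solution at distance zero,
    contradicting \<open>far\<close>.\<close>
  have "\<pi> > 0"
  proof (rule ccontr)
    assume "\<not> \<pi> > 0"
    then have "norm (w' - w) \<le> 0" "norm (r' - r) \<le> 0" using \<pi>(2,3) by linarith+
    then have "(w', r') = (w, r)" by simp
    with z0(1) far[of z0] show False by simp
  qed
  define \<tau> where "\<tau> = (1 + L) * \<pi>"
  have \<tau>: "\<tau> > 0" using L(2) \<open>\<pi> > 0\<close> by (simp add: \<tau>_def)
  text \<open>
    With the weight \<open>c\<^sup>2 / \<tau>\<close>, a value of at most \<open>\<tau>\<close> confines the minimiser to distance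
    \<open>\<tau> / c = \<kappa> * \<pi>\<close> from \<open>z0\<close>, where the penalty has gradient at most \<open>2 * c\<close>.
  \<close>
  define \<psi> where "\<psi> q = norm (snd q + H (fst q, w') - r') + c\<^sup>2 / \<tau> * ((fst q - z0) \<bullet> (fst q - z0))" for q
  define m0 where "m0 = r - H (z0, w)"
  have w\<delta>: "norm (w - wb) < \<delta> / 2" "norm (w' - wb) < \<delta> / 2" "norm (wb - wb) < \<delta> / 2"
    using w w' s\<rho>(2) \<rho>(2) \<delta>(1) by auto
  have "norm (z0 - zb) < \<delta> / 2"
    using z0 s\<rho>(2) \<rho>(2) by linarith
  note z0\<delta> = ball[OF this w\<delta>(1)] ball[OF this w\<delta>(2)]
  have zb\<delta>: "(zb, wb) \<in> ball (zb, wb) \<delta>" using \<delta>(1) by simp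
  have m0: "m0 \<in> M z0"
    using z0(1) S_iff z0\<delta>(1) \<delta>(4) by (auto simp: m0_def)
  have \<psi>0: "\<psi> (z0, m0) \<le> \<tau>"
  proof -
    \<comment> \<open>At z0 the penalty vanishes and the residual is caused solely by the change of
      parameters, which is why \<tau> = (1 + L) \<pi> bounds the initial value.\<close>
    have "\<psi> (z0, m0) = norm ((r - r') + (H (z0, w') - H (z0, w)))"
      by (simp add: \<psi>_def m0_def algebra_simps)
    also have "\<dots> \<le> norm (r' - r) + norm (H (z0, w') - H (z0, w))"
      using norm_triangle_ineq by (metis norm_minus_commute)
    also have "\<dots> \<le> \<pi> + L * \<pi>"
      using lip[OF z0\<delta>(2,1)] \<pi>(2,3) L(2) by (intro add_mono) (auto elim: order_trans)
    finally show ?thesis by (simp add: \<tau>_def algebra_simps)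
  qed
  \<comment> \<open>The box gives compactness. The bounds on s later place the minimizer in its
    interior, so it is a local minimizer over the whole graph.\<close>
  define Q where "Q = gph M \<inter> (cball zb \<rho> \<times> cball mb \<rho>)"
  have "compact Q"
    unfolding Q_def by (intro closed_Int_compact closed_gph compact_Times compact_cball)
  have "(z0, m0) \<in> Q"
  proof -
    have "norm (m0 - mb) \<le> norm (r - rb) + norm (H (z0, w) - H (zb, wb))"
      using norm_triangle_ineq4[of "r - rb" "H (z0, w) - H (zb, wb)"] by (simp add: m0_def algebra_simps)
    also have "\<dots> \<le> s + L * (s + s)"
      using lip[OF z0\<delta>(1) zb\<delta>] w z0(2) L(2)
      by (intro add_mono) (auto elim!: order_trans intro!: mult_left_mono)
    also have "\<dots> \<le> \<rho>"
      using s\<rho>(3) s \<open>s * L > 0\<close> \<open>s * (L * \<kappa>) > 0\<close> by (simp add: algebra_simps)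
    finally show ?thesis
      using m0 z0(2) s\<rho>(2) by (simp add: Q_def gph_def dist_norm norm_minus_commute)
  qed
  have "continuous_on Q \<psi>"
  proof -
    have "continuous_on (ball (zb, wb) \<delta>) H"
      using strict_H \<delta>(4) by (intro continuous_at_imp_continuous_on ballI differentiable_imp_continuous_within
          strictly_differentiable_imp_differentiable) auto
    then have "continuous_on Q (\<lambda>q. H (fst q, w'))"
    proof (rule continuous_on_compose2)
      show "continuous_on Q (\<lambda>q. (fst q, w'))"
        by (intro continuous_intros)
      show "(\<lambda>q. (fst q, w')) ` Q \<subseteq> ball (zb, wb) \<delta>"
        using \<rho>(2) w\<delta>(2) by (auto simp: Q_def simp del: mem_ball intro!: ball simp: dist_norm norm_minus_commute)
    qed
    then show ?thesis
      unfolding \<psi>_def by (intro continuous_intros)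
  qed
  then obtain q where q: "q \<in> Q" "\<And>q'. q' \<in> Q \<Longrightarrow> \<psi> q \<le> \<psi> q'"
    using continuous_attains_inf[OF \<open>compact Q\<close>] \<open>(z0, m0) \<in> Q\<close> by blast
  obtain z m where zm: "q = (z, m)" by fastforce
  have \<psi>q: "\<psi> (z, m) \<le> \<tau>"
    using order_trans[OF q(2)[OF \<open>(z0, m0) \<in> Q\<close>] \<psi>0] unfolding zm .
  define \<xi> where "\<xi> = m + H (z, w') - r'"
  have "c\<^sup>2 / \<tau> * ((z - z0) \<bullet> (z - z0)) \<ge> 0"
    using \<tau> by simp
  then have \<xi>: "norm \<xi> \<le> \<tau>" and "c\<^sup>2 / \<tau> * ((z - z0) \<bullet> (z - z0)) \<le> \<tau>"
    using \<psi>q norm_ge_zero[of \<xi>] unfolding \<psi>_def \<xi>_def by (auto simp del: norm_ge_zero)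
  then have "c\<^sup>2 * ((z - z0) \<bullet> (z - z0)) \<le> \<tau>\<^sup>2"
    using \<tau> by (simp add: field_simps power2_eq_square)
  then have "(c * norm (z - z0))\<^sup>2 \<le> \<tau>\<^sup>2"
    by (simp add: power_mult_distrib power2_norm_eq_inner)
  then have zz0: "c * norm (z - z0) \<le> \<tau>"
    by (rule power2_le_imp_le) (use \<tau> in linarith)
  then have zz0': "norm (z - z0) \<le> \<kappa> * \<pi>"
    using c by (simp add: \<kappa>_def \<tau>_def field_simps)
  have "\<kappa> * \<pi> \<le> 2 * (s * \<kappa>)"
    using \<kappa> \<pi>(1) by simp
  then have z_near: "norm (z - zb) < s + 2 * (s * \<kappa>)"
    using zz0' z0(2) norm_triangle_ineq[of "z - z0" "z0 - zb"] by simp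
  then have z\<rho>: "norm (z - zb) < \<rho>"
    using s\<rho>(1) by linarith
  then have z\<delta>: "(z, w') \<in> ball (zb, wb) \<delta>"
    using \<rho>(2) w\<delta>(2) by (intro ball) auto
  \<comment> \<open>The penalty does not involve m; its distance is controlled by m = \<xi> + r' - H
    (z, w') and the bound on the residual \<xi>.\<close>
  have m\<rho>: "norm (m - mb) < \<rho>"
  proof -
    have "norm (m - mb) \<le> norm \<xi> + norm (r' - rb) + norm (H (z, w') - H (zb, wb))"
      using norm_triangle_ineq4[of "\<xi> + (r' - rb)" "H (z, w') - H (zb, wb)"] norm_triangle_ineq[of \<xi> "r' - rb"]
      by (simp add: \<xi>_def algebra_simps)
    also have "norm (H (z, w') - H (zb, wb)) \<le> L * (norm (z - zb) + norm (w' - wb))"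
      by (rule lip[OF z\<delta> zb\<delta>])
    also have "\<dots> \<le> L * ((s + 2 * (s * \<kappa>)) + s)"
      using z_near w'(1) L(2) by (intro mult_left_mono) auto
    also have "norm \<xi> \<le> (1 + L) * (2 * s)"
    proof -
      have "\<tau> \<le> (1 + L) * (2 * s)"
        unfolding \<tau>_def using \<pi>(1) L(2) by (intro mult_left_mono) auto
      with \<xi> show ?thesis by linarith
    qed
    finally show ?thesis
      using w'(2) s\<rho>(3) by (simp add: algebra_simps)
  qed
  have zm_gph: "(z, m) \<in> gph M"
    using q(1) zm by (simp add: Q_def)
  \<comment> \<open>The minimizer lies within \<kappa> \<pi> of z0, where no solution for (w', r')
    exists.\<close>
  have "z \<notin> S (w', r')"
    using far[of z] zz0' by (auto simp: \<pi>_def norm_minus_commute)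
  then have "\<xi> \<noteq> 0"
    using S_iff[of z w' r'] z\<delta> \<delta>(4) zm_gph by (auto simp: \<xi>_def gph_def algebra_simps)
  define \<zeta> where "\<zeta> = sgn \<xi>"
  have \<zeta>: "norm \<zeta> = 1" using \<open>\<xi> \<noteq> 0\<close> by (simp add: \<zeta>_def norm_sgn)
  obtain B where B: "((\<lambda>z. H (z, w')) has_derivative B) (at z)"
    using has_derivative_at_slice(1) strict_H z\<delta> \<delta>(4) strictly_differentiable_imp_differentiable
    unfolding differentiable_def by blast
  \<comment> \<open>B is taken at (z, w') rather than at the base point; strict differentiability
    makes A a first-order approximation there with error \<epsilon> / 2.\<close>
  have BA: "norm (B h - A h) \<le> \<epsilon> / 2 * norm h" for h
  proof (rule derivative_bound[OF B])
    show "bounded_linear A" using deriv_A by (rule has_derivative_bounded_linear)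
    have "open ((\<lambda>z. (z, w')) -` ball (zb, wb) \<delta>)"
      by (intro open_vimage open_ball continuous_intros)
    then have "\<forall>\<^sub>F x in nhds z. (x, w') \<in> ball (zb, wb) \<delta>"
      using z\<delta> eventually_nhds_in_open by fastforce
    then show "\<forall>\<^sub>F x in nhds z. norm (H (x, w') - H (z, w') - A (x - z)) \<le> \<epsilon> / 2 * norm (x - z)"
      by eventually_elim (use z\<delta> \<delta>(2) \<delta>1(2) in blast)
  qed
  have lB: "linear B" using B by (rule has_derivative_linear)
  \<comment> \<open>Together with - \<zeta> this is minus the gradient of \<psi> at (z, m), so the
    unit vector \<beta> of the claim is - \<zeta>.\<close>
  define \<alpha> where "\<alpha> = - adjoint B \<zeta> - (2 * (c\<^sup>2 / \<tau>)) *\<^sub>R (z - z0)"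
  have "(\<alpha>, - \<zeta>) \<in> regular_normal_cone (gph M) (z, m)"
  proof (rule local_min_imp_regular_normal)
    have "((\<lambda>q. H (fst q, w')) has_derivative (\<lambda>h. B (fst h))) (at (z, m))"
      using has_derivative_compose[of fst fst "(z, m)" UNIV "\<lambda>z. H (z, w')" B] B
      by (simp add: has_derivative_fst)
    then have 1: "((\<lambda>q. snd q + H (fst q, w') - r') has_derivative (\<lambda>h. snd h + B (fst h))) (at (z, m))"
      by (auto intro!: derivative_eq_intros)
    have "(norm has_derivative (\<lambda>h. h \<bullet> \<zeta>)) (at \<xi>)"
      using has_derivative_norm[OF \<open>\<xi> \<noteq> 0\<close>] by (simp add: \<zeta>_def)
    then have 2: "((\<lambda>q. norm (snd q + H (fst q, w') - r')) has_derivative (\<lambda>h. (snd h + B (fst h)) \<bullet> \<zeta>)) (at (z, m))"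
      using has_derivative_compose[OF 1] by (simp add: \<xi>_def)
    have 3: "((\<lambda>q. c\<^sup>2 / \<tau> * ((fst q - z0) \<bullet> (fst q - z0))) has_derivative
        (\<lambda>h. c\<^sup>2 / \<tau> * ((z - z0) \<bullet> fst h + fst h \<bullet> (z - z0)))) (at (z, m))"
      by (auto intro!: derivative_eq_intros simp del: times_divide_eq_left)
    have "(\<psi> has_derivative (\<lambda>h. (snd h + B (fst h)) \<bullet> \<zeta> + c\<^sup>2 / \<tau> * ((z - z0) \<bullet> fst h + fst h \<bullet> (z - z0)))) (at (z, m))"
      unfolding \<psi>_def using 2 3 by (rule has_derivative_add)
    moreover have "(snd h + B (fst h)) \<bullet> \<zeta> + c\<^sup>2 / \<tau> * ((z - z0) \<bullet> fst h + fst h \<bullet> (z - z0))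
        = - ((\<alpha>, - \<zeta>) \<bullet> h)" for h
      using adjoint_works[OF lB, of "fst h" \<zeta>]
      by (simp add: \<alpha>_def inner_prod_def inner_add_left inner_diff_left inner_commute algebra_simps)
    ultimately show "(\<psi> has_derivative (\<lambda>h. - ((\<alpha>, - \<zeta>) \<bullet> h))) (at (z, m))"
      by simp
    show "(z, m) \<in> gph M" by (fact zm_gph)
    have "\<forall>\<^sub>F p in nhds (z, m). p \<in> ball zb \<rho> \<times> ball mb \<rho>"
      using z\<rho> m\<rho> by (intro eventually_nhds_in_open open_Times open_ball)
        (auto simp: dist_norm norm_minus_commute)
    then show "\<forall>\<^sub>F p in nhds (z, m). p \<in> gph M \<longrightarrow> \<psi> (z, m) \<le> \<psi> p"
      by eventually_elim (use q(2) zm in \<open>auto simp: Q_def\<close>)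
  qed
  moreover have "norm (\<alpha> - adjoint A (- \<zeta>)) \<le> \<epsilon>"
  proof -
    define d where "d = adjoint B \<zeta> - adjoint A \<zeta>"
    \<comment> \<open>Testing the difference of adjoints against itself transfers the bound on B - A
      to the adjoints.\<close>
    have "d \<bullet> d = (B d - A d) \<bullet> \<zeta>"
      by (subst d_def) (simp add: inner_diff_left inner_commute adjoint_works lB linear_A inner_diff_right)
    also have "\<dots> \<le> norm (B d - A d)"
      using norm_cauchy_schwarz[of "B d - A d" \<zeta>] \<zeta> by simp
    also have "\<dots> \<le> \<epsilon> / 2 * norm d" by (rule BA)
    finally have "norm d * norm d \<le> \<epsilon> / 2 * norm d"
      by (simp add: power2_norm_eq_inner[symmetric] power2_eq_square)
    then have d: "norm d \<le> \<epsilon> / 2"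
      using \<open>\<epsilon> > 0\<close> by (cases "d = 0") auto
    have "norm ((2 * (c\<^sup>2 / \<tau>)) *\<^sub>R (z - z0)) = 2 * c / \<tau> * (c * norm (z - z0))"
      using \<tau> by (simp add: power2_eq_square)
    also have "\<dots> \<le> 2 * c / \<tau> * \<tau>"
      using zz0 c \<tau> by (intro mult_left_mono) auto
    finally have e: "norm ((2 * (c\<^sup>2 / \<tau>)) *\<^sub>R (z - z0)) \<le> \<epsilon> / 2"
      using \<tau> by (simp add: c_def)
    have "\<alpha> - adjoint A (- \<zeta>) = - d - (2 * (c\<^sup>2 / \<tau>)) *\<^sub>R (z - z0)"
      by (simp add: \<alpha>_def d_def linear_neg[OF adjoint_linear[OF linear_A]])
    then show ?thesis
      using d e norm_triangle_ineq4[of "- d" "(2 * (c\<^sup>2 / \<tau>)) *\<^sub>R (z - z0)"] by simp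
  qed
  moreover have "norm (z - zb) < \<epsilon>" "norm (m - mb) < \<epsilon>"
    using z\<rho> m\<rho> \<rho>(3) by auto
  ultimately show thesis
    using \<zeta> that by simp
qed

text \<open>Approximate normals at the scales 1 / (k + 1) have their \<beta>-parts on the compact
  unit sphere. Along a convergent subsequence the \<alpha>-parts follow by continuity of the
  adjoint, and the limit violates the criterion.\<close>

lemma coderivative_criterion_imp_aubin:
  assumes criterion: "\<And>\<zeta>. (adjoint A \<zeta>, \<zeta>) \<in> limiting_normal_cone (gph M) (zb, mb) \<Longrightarrow> \<zeta> = 0"
  shows "aubin_property S (wb, rb) zb"
proof (rule ccontr)
  assume not_aubin: "\<not> aubin_property S (wb, rb) zb"
  have "\<exists>z m \<alpha> \<beta>. norm (z - zb) < 1 / real (Suc k) \<and> norm (m - mb) < 1 / real (Suc k) \<and>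
      (\<alpha>, \<beta>) \<in> regular_normal_cone (gph M) (z, m) \<and> norm \<beta> = 1 \<and>
      norm (\<alpha> - adjoint A \<beta>) \<le> 1 / real (Suc k)" for k
  proof -
    have "1 / real (Suc k) > 0" by simp
    with not_aubin show ?thesis
      by (rule not_aubin_imp_approximate_normal) blast
  qed
  then obtain z m \<alpha> \<beta> where
    z: "\<And>k. norm (z k - zb) < 1 / real (Suc k)" and m: "\<And>k. norm (m k - mb) < 1 / real (Suc k)" and
    normal: "\<And>k. (\<alpha> k, \<beta> k) \<in> regular_normal_cone (gph M) (z k, m k)" and
    \<beta>: "\<And>k. norm (\<beta> k) = 1" and \<alpha>: "\<And>k. norm (\<alpha> k - adjoint A (\<beta> k)) \<le> 1 / real (Suc k)"
    by metis
  have lim0: "(\<lambda>k. 1 / real (Suc k)) \<longlonglongrightarrow> 0"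
    by (rule LIMSEQ_Suc[OF lim_1_over_n])
  have "z \<longlonglongrightarrow> zb" "m \<longlonglongrightarrow> mb" and \<alpha>0: "(\<lambda>k. \<alpha> k - adjoint A (\<beta> k)) \<longlonglongrightarrow> 0"
    using z m \<alpha> by (intro LIM_zero_cancel[of z] LIM_zero_cancel[of m] Lim_null_comparison[OF _ lim0]
        eventuallyI; simp add: less_imp_le)+
  have "seq_compact (sphere (0::'z) 1)" "\<And>k. \<beta> k \<in> sphere 0 1"
    using compact_sphere[of "0::'z" 1] \<beta> by (simp_all add: compact_eq_seq_compact_metric)
  then obtain \<zeta> \<sigma> where \<sigma>: "\<zeta> \<in> sphere 0 1" "strict_mono \<sigma>" "(\<beta> \<circ> \<sigma>) \<longlonglongrightarrow> \<zeta>"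
    using seq_compactE[of "sphere 0 1" \<beta> thesis] by (metis (no_types))
  have bl: "bounded_linear (adjoint A)"
    using adjoint_linear[OF linear_A] by (simp add: linear_conv_bounded_linear)
  have "(\<lambda>k. adjoint A (\<beta> (\<sigma> k))) \<longlonglongrightarrow> adjoint A \<zeta>"
    using bounded_linear.tendsto[OF bl \<sigma>(3)] by (simp only: o_def)
  moreover have "(\<lambda>k. \<alpha> (\<sigma> k) - adjoint A (\<beta> (\<sigma> k))) \<longlonglongrightarrow> 0"
    using LIMSEQ_subseq_LIMSEQ[OF \<alpha>0 \<sigma>(2)] by (simp add: o_def)
  ultimately have "(\<lambda>k. \<alpha> (\<sigma> k)) \<longlonglongrightarrow> adjoint A \<zeta>"
    using tendsto_add by fastforce
  moreover have "(\<lambda>k. \<beta> (\<sigma> k)) \<longlonglongrightarrow> \<zeta>"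
    using \<sigma>(3) by (simp add: o_def)
  moreover have "(\<lambda>k. z (\<sigma> k)) \<longlonglongrightarrow> zb" "(\<lambda>k. m (\<sigma> k)) \<longlonglongrightarrow> mb"
    using LIMSEQ_subseq_LIMSEQ[OF \<open>z \<longlonglongrightarrow> zb\<close> \<sigma>(2)] LIMSEQ_subseq_LIMSEQ[OF \<open>m \<longlonglongrightarrow> mb\<close> \<sigma>(2)]
    by (simp_all add: o_def)
  ultimately have "(adjoint A \<zeta>, \<zeta>) \<in> limiting_normal_cone (gph M) (zb, mb)"
    by (intro limiting_normal_coneI[where u = "\<lambda>k. (\<alpha> (\<sigma> k), \<beta> (\<sigma> k))" and z = "\<lambda>k. (z (\<sigma> k), m (\<sigma> k))"]
        base_mem normal tendsto_Pair)
  then have "\<zeta> = 0" by (rule criterion)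
  with \<sigma>(1) show False by simp
qed

theorem aubin_iff_coderivative_criterion:
  "aubin_property S (wb, rb) zb \<longleftrightarrow>
     (\<forall>\<zeta>. (adjoint A \<zeta>, \<zeta>) \<in> limiting_normal_cone (gph M) (zb, mb) \<longrightarrow> \<zeta> = 0)"
  using aubin_imp_coderivative_criterion coderivative_criterion_imp_aubin by blast

end


section \<open>Blocks and the Lagrangian\<close>

lemma linear_block: "linear (block own \<nu>)"
  by (rule linearI) (auto simp: block_def vec_eq_iff)

lemma block_in_block_space: "block own \<nu> x \<in> block_space own \<nu>"
  by (simp add: block_def block_space_def)

lemma block_nth: "block own \<nu> x $ i = (if own i = \<nu> then x $ i else 0)"
  by (simp add: block_def)

lemma block_idem: "x \<in> block_space own \<nu> \<Longrightarrow> block own \<nu> x = x"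
  by (auto simp: block_def block_space_def vec_eq_iff)

lemma block_block: "block own \<nu> (block own \<mu> x) = (if \<nu> = \<mu> then block own \<nu> x else 0)"
  by (auto simp: block_def vec_eq_iff)

lemma inner_block: "block own \<nu> x \<bullet> y = x \<bullet> block own \<nu> y"
  by (auto simp: block_def inner_vec_def intro!: sum.cong)

lemma inner_block_block: "block own \<nu> x \<bullet> block own \<nu> y = x \<bullet> block own \<nu> y"
  by (simp add: inner_block block_block)

lemma sum_block:
  fixes own :: "'n::finite \<Rightarrow> 'p::finite"
  shows "(\<Sum>\<nu>\<in>UNIV. block own \<nu> (x \<nu>)) = (\<chi> i. x (own i) $ i)"
  by (simp add: vec_eq_iff block_nth)

lemma sum_block_const:
  fixes own :: "'n::finite \<Rightarrow> 'p::finite"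
  shows "(\<Sum>\<nu>\<in>UNIV. block own \<nu> x) = x"
  by (simp add: sum_block)

text \<open>Changing a single block of x to an admissible strategy isolates the inequality of one
  player; conversely the inner product with z - x is the sum over the blocks. Thus the conditions of
  all players merge into one normal cone.\<close>

lemma normal_cone_block_product:
  fixes own :: "'n::finite \<Rightarrow> 'p::finite"
  assumes X: "\<And>\<nu>. X \<nu> \<subseteq> block_space own \<nu>"
  shows "c \<in> normal_cone (block_product own X) x \<longleftrightarrow>
    (\<forall>\<nu>. block own \<nu> c \<in> normal_cone (X \<nu>) (block own \<nu> x))"
proof
  assume c: "c \<in> normal_cone (block_product own X) x"
  then have x: "block own \<nu> x \<in> X \<nu>" for \<nu>
    by (auto simp: normal_cone_def block_product_def split: if_splits)
  have "block own \<nu> c \<bullet> (v - block own \<nu> x) \<le> 0" if v: "v \<in> X \<nu>" for \<nu> v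
  proof -
    have v': "block own \<nu> v = v"
      using v X by (intro block_idem) blast
    \<comment> \<open>Only the block of \<nu> changes, because v is supported on that block.\<close>
    define z where "z = x + (v - block own \<nu> x)"
    have "block own \<mu> z \<in> X \<mu>" for \<mu>
    proof (cases "\<mu> = \<nu>")
      case True
      then show ?thesis
        using v v' by (simp add: z_def linear_add linear_diff linear_block block_block)
    next
      case False
      then have "block own \<mu> v = 0"
        using v' block_block[of own \<mu> \<nu> v] by simp
      with False show ?thesis
        using x by (simp add: z_def linear_add linear_diff linear_block block_block)
    qed
    then have "c \<bullet> (z - x) \<le> 0"
      using c by (auto simp: normal_cone_def block_product_def split: if_splits)
    then show ?thesis
      using v' by (simp add: z_def inner_block linear_diff linear_block block_block)
  qed
  with x show "\<forall>\<nu>. block own \<nu> c \<in> normal_cone (X \<nu>) (block own \<nu> x)"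
    by (simp add: normal_cone_def)
next
  assume c: "\<forall>\<nu>. block own \<nu> c \<in> normal_cone (X \<nu>) (block own \<nu> x)"
  then have x: "x \<in> block_product own X"
    by (auto simp: normal_cone_def block_product_def split: if_splits)
  have "c \<bullet> (z - x) \<le> 0" if z: "z \<in> block_product own X" for z
  proof -
    have "c \<bullet> (z - x) = (\<Sum>\<nu>\<in>UNIV. block own \<nu> c) \<bullet> (z - x)"
      by (simp add: sum_block_const)
    also have "\<dots> = (\<Sum>\<nu>\<in>UNIV. block own \<nu> c \<bullet> (block own \<nu> z - block own \<nu> x))"
      unfolding inner_sum_left
      by (simp add: inner_block block_block linear_diff[OF linear_block])
    also have "\<dots> \<le> 0"
    proof (rule sum_nonpos)
      fix \<nu>
      show "block own \<nu> c \<bullet> (block own \<nu> z - block own \<nu> x) \<le> 0"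
        using c z by (auto simp: normal_cone_def block_product_def split: if_splits)
    qed
    finally show ?thesis .
  qed
  with x show "c \<in> normal_cone (block_product own X) x"
    by (simp add: normal_cone_def)
qed

lemma closed_block_product:
  assumes "\<And>\<nu>. closed (X \<nu>)"
  shows "closed (block_product own X)"
proof -
  have "block_product own X = (\<Inter>\<nu>. block own \<nu> -` X \<nu>)"
    by (auto simp: block_product_def)
  then show ?thesis
    using assms
    by (simp add: closed_INT closed_vimage linear_continuous_on linear_block[unfolded linear_conv_bounded_linear])
qed

section \<open>Gradients, partial gradients and adjoints\<close>

lemma grad_eqI:
  assumes "(\<phi> has_derivative (\<lambda>h. h \<bullet> D)) (at x)"
  shows "grad \<phi> x = D"
  unfolding grad_def
proof (rule the_equality)
  show "GDERIV \<phi> x :> D"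
    using assms by (simp add: gderiv_def)
  fix E assume "GDERIV \<phi> x :> E"
  then have "(\<lambda>h. h \<bullet> E) = (\<lambda>h. h \<bullet> D)"
    using assms unfolding gderiv_def by (metis has_derivative_unique)
  then have "(E - D) \<bullet> (E - D) = 0"
    by (simp add: inner_diff_right fun_eq_iff)
  then show "E = D"
    by simp
qed

text \<open>The Riesz vector of the derivative is its adjoint applied to the scalar 1.\<close>

lemma has_derivative_grad:
  fixes \<phi> :: "'a::euclidean_space \<Rightarrow> real"
  assumes "\<phi> differentiable (at x)"
  shows "(\<phi> has_derivative (\<lambda>h. h \<bullet> grad \<phi> x)) (at x)"
proof -
  obtain \<phi>' where \<phi>': "(\<phi> has_derivative \<phi>') (at x)"
    using assms by (auto simp: differentiable_def)
  have "\<phi>' = (\<lambda>h. h \<bullet> adjoint \<phi>' 1)"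
    using adjoint_works[OF has_derivative_linear[OF \<phi>']] by auto
  with \<phi>' have "(\<phi> has_derivative (\<lambda>h. h \<bullet> adjoint \<phi>' 1)) (at x)"
    by metis
  with grad_eqI[OF this] show ?thesis
    by simp
qed

lemma block_subst_eq: "block_subst own \<nu> \<xi> x = block own \<nu> \<xi> + (x - block own \<nu> x)"
  by (auto simp: block_subst_def block_def vec_eq_iff)

lemma block_subst_self [simp]: "block_subst own \<nu> x x = x"
  by (simp add: block_subst_eq)

lemma has_derivative_block_subst:
  "((\<lambda>\<xi>. block_subst own \<nu> \<xi> x) has_derivative block own \<nu>) (at \<xi>)"
proof -
  have "(block own \<nu> has_derivative block own \<nu>) (at \<xi>)"
    by (intro bounded_linear_imp_has_derivative linear_block[unfolded linear_conv_bounded_linear])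
  from has_derivative_add[OF this has_derivative_const[of "x - block own \<nu> x"]]
  show ?thesis by (simp add: block_subst_eq)
qed

text \<open>The chain rule through the substitution projects the direction h onto the block; since
  the projection is self-adjoint, it can be moved onto the gradient.\<close>

lemma block_grad_eqI:
  assumes "(\<phi> has_derivative (\<lambda>h. h \<bullet> D)) (at x)"
  shows "block_grad own \<nu> \<phi> x = block own \<nu> D"
  unfolding block_grad_def
proof (rule grad_eqI)
  have "((\<lambda>\<xi>. \<phi> (block_subst own \<nu> \<xi> x)) has_derivative (\<lambda>h. block own \<nu> h \<bullet> D)) (at x)"
    using has_derivative_compose[OF has_derivative_block_subst[of own \<nu> x x], of \<phi> "\<lambda>h. h \<bullet> D"] assms
    by simp
  then show "((\<lambda>\<xi>. \<phi> (block_subst own \<nu> \<xi> x)) has_derivative (\<lambda>h. h \<bullet> block own \<nu> D)) (at x)"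
    by (simp add: inner_block)
qed

text \<open>Makes the multiplier term of the Lagrangian gradient a bounded bilinear expression in
  the derivative of F and y. The norm bound comes from |T* y|^2 = T (T* y) \<bullet> y.\<close>

lemma bounded_bilinear_adjoint:
  "bounded_bilinear (\<lambda>(T :: 'a::euclidean_space \<Rightarrow>\<^sub>L 'b::euclidean_space) y. adjoint (blinfun_apply T) y)"
proof -
  have lin: "linear (blinfun_apply T)" for T :: "'a \<Rightarrow>\<^sub>L 'b"
    by (simp add: blinfun.bounded_linear_right bounded_linear.linear)
  note works = adjoint_works[OF lin]
  show ?thesis
  proof
    fix T U :: "'a \<Rightarrow>\<^sub>L 'b" and y z :: 'b and r :: real
    show "adjoint (blinfun_apply (T + U)) y = adjoint (blinfun_apply T) y + adjoint (blinfun_apply U) y"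
      by (rule vector_eq_ldot[THEN iffD1], rule allI)
        (simp add: inner_add_right works blinfun.add_left inner_add_left)
    show "adjoint (blinfun_apply (r *\<^sub>R T)) y = r *\<^sub>R adjoint (blinfun_apply T) y"
      by (rule vector_eq_ldot[THEN iffD1], rule allI) (simp add: works blinfun.scaleR_left)
    show "adjoint (blinfun_apply T) (y + z) = adjoint (blinfun_apply T) y + adjoint (blinfun_apply T) z"
      "adjoint (blinfun_apply T) (r *\<^sub>R y) = r *\<^sub>R adjoint (blinfun_apply T) y"
      using adjoint_linear[OF lin, of T] by (simp_all add: linear_add linear_scale)
  next
    have "norm (adjoint (blinfun_apply T) y) \<le> norm T * norm y * 1" for T :: "'a \<Rightarrow>\<^sub>L 'b" and y
    proof -
      let ?a = "adjoint (blinfun_apply T) y"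
      have "norm ?a * norm ?a = blinfun_apply T ?a \<bullet> y"
        by (simp add: works[symmetric] flip: power2_norm_eq_inner power2_eq_square)
      also have "\<dots> \<le> norm (blinfun_apply T ?a) * norm y"
        by (rule norm_cauchy_schwarz)
      also have "\<dots> \<le> (norm T * norm ?a) * norm y"
        by (intro mult_right_mono norm_blinfun) simp
      finally show ?thesis
        by (cases "?a = 0") (simp_all add: mult_ac)
    qed
    then show "\<exists>K. \<forall>(T :: 'a \<Rightarrow>\<^sub>L 'b) y. norm (adjoint (blinfun_apply T) y) \<le> norm T * norm y * K"
      by blast
  qed
qed

lemma linear_eq_sum_axis:
  fixes f :: "real ^ 'n::finite \<Rightarrow> 'b::real_vector"
  assumes "linear f"
  shows "f h = (\<Sum>j\<in>UNIV. h $ j *\<^sub>R f (axis j 1))"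
proof -
  have "f h = f (\<Sum>j\<in>UNIV. h $ j *s axis j 1)"
    by (simp add: basis_expansion)
  then show ?thesis
    by (simp add: linear_sum[OF assms] linear_scale[OF assms] scalar_mult_eq_scaleR)
qed

section \<open>The residual of the equilibrium conditions and its derivative\<close>

text \<open>The full x-gradient of the Lagrangian of one player without the perturbations v and u,
  at points where f and F are differentiable in x; the block of the player is selected
  separately.\<close>

definition lag_gradient ::
  "('p \<Rightarrow> (real ^ 'n::finite) \<times> 'w \<Rightarrow> real) \<Rightarrow> ((real ^ 'n) \<times> 'w \<Rightarrow> 'y::euclidean_space) \<Rightarrow>
   'p \<Rightarrow> ((real ^ 'n) \<times> 'y) \<times> 'w \<Rightarrow> real ^ 'n" where
  "lag_gradient f F \<nu> = (\<lambda>((x, y), w). grad\<^sub>x (f \<nu>) (x, w) + adjoint (blinfun_apply (D\<^sub>x F (x, w))) y)"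

text \<open>The single-valued part of the equilibrium system: coordinate i comes from the Lagrangian
  of its owner, and the second component carries the sign for which the perturbation becomes the
  translation (v, -u).\<close>

definition residual_map ::
  "('n \<Rightarrow> 'p) \<Rightarrow> ('p \<Rightarrow> (real ^ 'n::finite) \<times> 'w \<Rightarrow> real) \<Rightarrow>
   ((real ^ 'n) \<times> 'w \<Rightarrow> 'y::euclidean_space) \<Rightarrow> ((real ^ 'n) \<times> 'y) \<times> 'w \<Rightarrow> (real ^ 'n) \<times> 'y" where
  "residual_map own f F q =
     (\<chi> i. lag_gradient f F (own i) q $ i, - F (fst (fst q), snd q))"

lemma blinfun_apply_D\<^sub>x:
  assumes "(\<lambda>\<xi>. \<phi> (\<xi>, w)) differentiable (at x)"
  shows "blinfun_apply (D\<^sub>x \<phi> (x, w)) = frechet_derivative (\<lambda>\<xi>. \<phi> (\<xi>, w)) (at x)"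
proof -
  have "bounded_linear (frechet_derivative (\<lambda>\<xi>. \<phi> (\<xi>, w)) (at x))"
    using assms frechet_derivative_works has_derivative_bounded_linear by blast
  then show ?thesis
    by (simp add: D\<^sub>x_def bounded_linear_Blinfun_apply)
qed

lemma has_derivative_D\<^sub>x:
  assumes "(\<lambda>\<xi>. \<phi> (\<xi>, w)) differentiable (at x)"
  shows "((\<lambda>\<xi>. \<phi> (\<xi>, w)) has_derivative blinfun_apply (D\<^sub>x \<phi> (x, w))) (at x)"
  using assms by (simp add: blinfun_apply_D\<^sub>x frechet_derivative_works)

lemma strictly_differentiable_imp_differentiable_slice:
  assumes "strictly_differentiable \<phi> (x, w)"
  shows "(\<lambda>\<xi>. \<phi> (\<xi>, w)) differentiable (at x)"
  using strictly_differentiable_imp_differentiable[OF assms] has_derivative_at_slice(1)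
  unfolding differentiable_def by blast

lemma has_derivative_lagrangian:
  assumes f: "(\<lambda>\<xi>. f \<nu> (\<xi>, w)) differentiable (at x)" and F: "(\<lambda>\<xi>. F (\<xi>, w)) differentiable (at x)"
  shows "((\<lambda>\<xi>. f \<nu> (\<xi>, w) + y \<bullet> F (\<xi>, w)) has_derivative
    (\<lambda>h. h \<bullet> lag_gradient f F \<nu> ((x, y), w))) (at x)"
proof -
  let ?T = "blinfun_apply (D\<^sub>x F (x, w))"
  have "((\<lambda>\<xi>. f \<nu> (\<xi>, w) + y \<bullet> F (\<xi>, w)) has_derivative
      (\<lambda>h. h \<bullet> grad (\<lambda>\<xi>. f \<nu> (\<xi>, w)) x + y \<bullet> ?T h)) (at x)"
    by (intro has_derivative_add has_derivative_grad[OF f] has_derivative_inner_right has_derivative_D\<^sub>x[OF F])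
  moreover have "h \<bullet> grad (\<lambda>\<xi>. f \<nu> (\<xi>, w)) x + y \<bullet> ?T h = h \<bullet> lag_gradient f F \<nu> ((x, y), w)" for h
    using adjoint_works[OF has_derivative_linear[OF has_derivative_D\<^sub>x[OF F]], of h y]
    by (simp add: lag_gradient_def grad\<^sub>x_def inner_add_right inner_commute)
  ultimately show ?thesis
    by simp
qed

text \<open>The shift u contributes a constant, and v enters through its own block only, which the
  outer projection leaves unchanged.\<close>

lemma block_grad_lagrangian:
  assumes f: "(\<lambda>\<xi>. f \<nu> (\<xi>, w)) differentiable (at x)" and F: "(\<lambda>\<xi>. F (\<xi>, w)) differentiable (at x)"
  shows "block_grad own \<nu> (\<lambda>\<xi>. lagrangian own f F \<nu> \<xi> y (w, v, u)) x
    = block own \<nu> (lag_gradient f F \<nu> ((x, y), w) - v)"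
proof -
  have "((\<lambda>\<xi>. (f \<nu> (\<xi>, w) + y \<bullet> F (\<xi>, w)) - \<xi> \<bullet> block own \<nu> v - y \<bullet> u) has_derivative
      (\<lambda>h. h \<bullet> lag_gradient f F \<nu> ((x, y), w) - h \<bullet> block own \<nu> v - 0)) (at x)"
    by (intro has_derivative_diff has_derivative_lagrangian f F has_derivative_const
        has_derivative_inner_left has_derivative_ident)
  moreover have "lagrangian own f F \<nu> \<xi> y (w, v, u)
      = (f \<nu> (\<xi>, w) + y \<bullet> F (\<xi>, w)) - \<xi> \<bullet> block own \<nu> v - y \<bullet> u" for \<xi>
    using inner_block_block[of own \<nu> v \<xi>] inner_block[of own \<nu> v \<xi>]
    by (simp add: lagrangian_def inner_diff_right inner_commute)
  ultimately have "((\<lambda>\<xi>. lagrangian own f F \<nu> \<xi> y (w, v, u)) has_derivative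
      (\<lambda>h. h \<bullet> (lag_gradient f F \<nu> ((x, y), w) - block own \<nu> v))) (at x)"
    by (simp add: inner_diff_right)
  from block_grad_eqI[OF this, of own \<nu>] show ?thesis
    by (simp add: linear_diff[OF linear_block] block_block)
qed

lemma zero_in_plus_image_iff:
  fixes a :: "'a::ab_group_add"
  shows "0 \<in> (+) a ` C \<longleftrightarrow> - a \<in> C"
  by (auto simp: image_iff eq_commute[of 0] add_eq_0_iff)

lemma block_residual:
  "block own \<nu> (fst (residual_map own f F q)) = block own \<nu> (lag_gradient f F \<nu> q)"
  by (auto simp: vec_eq_iff block_nth residual_map_def)

lemma S_Lag_iff_residual:
  fixes own :: "'n::finite \<Rightarrow> 'p::finite"
  assumes X: "\<And>\<nu>. X \<nu> \<subseteq> block_space own \<nu>"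
    and f: "\<And>\<nu>. (\<lambda>\<xi>. f \<nu> (\<xi>, w)) differentiable (at x)"
    and F: "(\<lambda>\<xi>. F (\<xi>, w)) differentiable (at x)"
  shows "(x, y) \<in> S_Lag own f F X K (w, v, u) \<longleftrightarrow>
    (v, - u) - residual_map own f F ((x, y), w)
      \<in> normal_cone (block_product own X) x \<times> normal_cone (polar K) y"
proof -
  let ?R = "residual_map own f F ((x, y), w)"
  have "- block own \<nu> (lag_gradient f F \<nu> ((x, y), w) - v) = block own \<nu> (v - fst ?R)" for \<nu>
    by (simp add: linear_diff[OF linear_block] block_residual)
  moreover have "- (- F (x, w) + u) = - u - snd ?R"
    by (simp add: residual_map_def)
  ultimately show ?thesis
    by (simp only: S_Lag_def split case_prod_conv mem_Collect_eq zero_in_plus_image_iff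
        block_grad_lagrangian[OF f F] Int_iff block_in_block_space simp_thms
        normal_cone_block_product[OF X] mem_Times_iff fst_diff snd_diff fst_conv snd_conv)
qed

lemma strictly_differentiable_lag_gradient:
  assumes f: "strictly_differentiable (grad\<^sub>x (f \<nu>)) (x, w)" and F: "strictly_differentiable (D\<^sub>x F) (x, w)"
  shows "strictly_differentiable (lag_gradient f F \<nu>) ((x, y), w)"
proof -
  have proj: "strictly_differentiable (\<lambda>q. (fst (fst q), snd q)) ((x, y), w)"
    and proj': "strictly_differentiable (\<lambda>q. snd (fst q)) ((x, y), w)"
    by (intro strictly_differentiable_bounded_linear bounded_linear_Pair bounded_linear_fst bounded_linear_snd
        bounded_linear_compose[OF bounded_linear_fst] bounded_linear_compose[OF bounded_linear_snd])+
  have "strictly_differentiable (\<lambda>q. grad\<^sub>x (f \<nu>) (fst (fst q), snd q)) ((x, y), w)"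
    using strictly_differentiable_compose[OF proj, of "grad\<^sub>x (f \<nu>)"] f by simp
  moreover have "strictly_differentiable (\<lambda>q. (D\<^sub>x F (fst (fst q), snd q), snd (fst q))) ((x, y), w)"
    using strictly_differentiable_Pair[OF strictly_differentiable_compose[OF proj, of "D\<^sub>x F"] proj'] F by simp
  from strictly_differentiable_compose[OF this strictly_differentiable_bilinear[OF bounded_bilinear_adjoint]]
  have "strictly_differentiable (\<lambda>q. adjoint (blinfun_apply (D\<^sub>x F (fst (fst q), snd q))) (snd (fst q))) ((x, y), w)"
    by simp
  ultimately have "strictly_differentiable (\<lambda>q. grad\<^sub>x (f \<nu>) (fst (fst q), snd q) +
      adjoint (blinfun_apply (D\<^sub>x F (fst (fst q), snd q))) (snd (fst q))) ((x, y), w)"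
    by (rule strictly_differentiable_add)
  then show ?thesis
    by (simp add: lag_gradient_def case_prod_unfold)
qed

text \<open>Selecting each coordinate from its owner is a finite sum of block projections, so the
  sum and chain rules for strict derivatives apply.\<close>

lemma strictly_differentiable_residual_map:
  fixes own :: "'n::finite \<Rightarrow> 'p::finite"
  assumes f: "\<And>\<nu>. strictly_differentiable (grad\<^sub>x (f \<nu>)) (x, w)" and DF: "strictly_differentiable (D\<^sub>x F) (x, w)"
    and F: "strictly_differentiable F (x, w)"
  shows "strictly_differentiable (residual_map own f F) ((x, y), w)"
proof -
  have "strictly_differentiable (\<lambda>q. block own \<nu> (lag_gradient f F \<nu> q)) ((x, y), w)" for \<nu>
    by (intro strictly_differentiable_compose[OF strictly_differentiable_lag_gradient[OF f DF]]
        strictly_differentiable_bounded_linear linear_block[unfolded linear_conv_bounded_linear])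
  then have 1: "strictly_differentiable (\<lambda>q. \<Sum>\<nu>\<in>UNIV. block own \<nu> (lag_gradient f F \<nu> q)) ((x, y), w)"
    by (rule strictly_differentiable_sum)
  have "strictly_differentiable (\<lambda>q. (fst (fst q), snd q)) ((x, y), w)"
    by (intro strictly_differentiable_bounded_linear bounded_linear_Pair bounded_linear_fst bounded_linear_snd
        bounded_linear_compose[OF bounded_linear_fst])
  from strictly_differentiable_compose[OF this, of F] F
  have "strictly_differentiable (\<lambda>q. F (fst (fst q), snd q)) ((x, y), w)"
    by simp
  from strictly_differentiable_compose[OF this, of uminus]
  have 2: "strictly_differentiable (\<lambda>q. - F (fst (fst q), snd q)) ((x, y), w)"
    by (simp add: strictly_differentiable_bounded_linear bounded_linear_minus bounded_linear_ident)
  from strictly_differentiable_Pair[OF 1 2] show ?thesis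
    by (simp add: sum_block residual_map_def[abs_def])
qed

text \<open>
  The multiplier enters \<^const>\<open>residual_map\<close> linearly, so only the primal direction has to be
  matched against the second derivatives collected in \<^const>\<open>pseudohessian\<close>.
\<close>

lemma has_derivative_residual_map:
  fixes own :: "'n::finite \<Rightarrow> 'p::finite"
    and f :: "'p \<Rightarrow> (real ^ 'n) \<times> 'w::real_normed_vector \<Rightarrow> real"
    and F :: "(real ^ 'n) \<times> 'w \<Rightarrow> 'y::euclidean_space" and wb :: 'w
  defines "l \<equiv> \<lambda>\<nu> x y. f \<nu> (x, wb) + y \<bullet> F (x, wb)"
  assumes nbhd: "open W" "(xb, wb) \<in> W"
    and f: "\<And>\<nu> z. z \<in> W \<Longrightarrow> strictly_differentiable (f \<nu>) z"
    and F: "\<And>z. z \<in> W \<Longrightarrow> strictly_differentiable F z"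
    and grad_f: "\<And>\<nu>. strictly_differentiable (grad\<^sub>x (f \<nu>)) (xb, wb)"
    and DF: "strictly_differentiable (D\<^sub>x F) (xb, wb)"
  shows "((\<lambda>z. residual_map own f F (z, wb)) has_derivative
    (\<lambda>h. (pseudohessian own l xb yb *v fst h + adjoint (blinfun_apply (D\<^sub>x F (xb, wb))) (snd h),
          - blinfun_apply (D\<^sub>x F (xb, wb)) (fst h)))) (at (xb, yb))"
proof -
  let ?T = "blinfun_apply (D\<^sub>x F (xb, wb))"
  let ?P = "lag_gradient f F"
  have fd: "(\<lambda>\<xi>. f \<nu> (\<xi>, w)) differentiable (at x)" and Fd: "(\<lambda>\<xi>. F (\<xi>, w)) differentiable (at x)"
    if "(x, w) \<in> W" for \<nu> x w
    using f F that by (auto intro: strictly_differentiable_imp_differentiable_slice)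
  have "\<exists>P'. \<forall>\<nu>. (?P \<nu> has_derivative P' \<nu>) (at ((xb, yb), wb))"
    using strictly_differentiable_imp_differentiable[OF strictly_differentiable_lag_gradient[OF grad_f DF]]
    unfolding differentiable_def by (intro choice allI)
  then obtain P' where P': "(?P \<nu> has_derivative P' \<nu>) (at ((xb, yb), wb))" for \<nu>
    by blast
  have P'z: "((\<lambda>z. ?P \<nu> (z, wb)) has_derivative (\<lambda>h. P' \<nu> (h, 0))) (at (xb, yb))" for \<nu>
    by (rule has_derivative_at_slice(1)[OF P'])
  have P'x: "((\<lambda>\<xi>. ?P \<nu> ((\<xi>, yb), wb)) has_derivative (\<lambda>h. P' \<nu> ((h, 0), 0))) (at xb)" for \<nu>
    by (rule has_derivative_at_slice(1)[OF P'z])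
  \<comment> \<open>For fixed x and w the gradient is affine in y, so its derivative is read off
    directly and identified by uniqueness.\<close>
  have P'y: "P' \<nu> ((0, k), 0) = adjoint ?T k" for \<nu> k
  proof -
    have "((\<lambda>y. ?P \<nu> ((xb, y), wb)) has_derivative (\<lambda>h. P' \<nu> ((0, h), 0))) (at yb)"
      by (rule has_derivative_at_slice(2)[OF P'z])
    moreover have "bounded_linear (adjoint ?T)"
      using bounded_bilinear.bounded_linear_right[OF bounded_bilinear_adjoint] .
    then have "((\<lambda>y. ?P \<nu> ((xb, y), wb)) has_derivative (\<lambda>h. 0 + adjoint ?T h)) (at yb)"
      unfolding lag_gradient_def split
      by (intro has_derivative_add has_derivative_const bounded_linear_imp_has_derivative)
    ultimately have "(\<lambda>h. P' \<nu> ((0, h), 0)) = (\<lambda>h. 0 + adjoint ?T h)"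
      by (rule has_derivative_unique)
    from fun_cong[OF this, of k] show ?thesis by simp
  qed
  have G: "pseudohessian own l xb yb $ i $ j = P' (own i) ((axis j 1, 0), 0) $ i" for i j
  proof -
    let ?\<Phi> = "block_grad own (own i) (\<lambda>z. l (own i) z yb)"
    have W: "open ((\<lambda>x. (x, wb)) -` W)" "xb \<in> (\<lambda>x. (x, wb)) -` W"
      using nbhd by (auto intro!: open_vimage continuous_intros)
    have deriv: "((\<lambda>\<xi>. block own (own i) (?P (own i) ((\<xi>, yb), wb))) has_derivative
        (\<lambda>h. block own (own i) (P' (own i) ((h, 0), 0)))) (at xb)"
      by (rule bounded_linear.has_derivative[OF linear_block[unfolded linear_conv_bounded_linear] P'x])
    have eq: "block own (own i) (?P (own i) ((x, yb), wb)) = ?\<Phi> x" if "x \<in> (\<lambda>x. (x, wb)) -` W" for x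
      using that unfolding l_def
      by (intro block_grad_eqI[symmetric] has_derivative_lagrangian fd Fd) simp_all
    \<comment> \<open>The partial gradient is known to agree with the projected full gradient only
      on the open slice of W, which suffices for its derivative at \<open>xb\<close>.\<close>
    have "(?\<Phi> has_derivative (\<lambda>h. block own (own i) (P' (own i) ((h, 0), 0)))) (at xb)"
      using has_derivative_transform_within_open[OF deriv W eq] .
    then have "((\<lambda>\<xi>. ?\<Phi> (block_subst own (own j) \<xi> xb)) has_derivative
        (\<lambda>h. block own (own i) (P' (own i) ((block own (own j) h, 0), 0)))) (at xb)"
      using has_derivative_compose[OF has_derivative_block_subst[of own "own j" xb xb], of ?\<Phi>] by simp
    then have "frechet_derivative (\<lambda>\<xi>. ?\<Phi> (block_subst own (own j) \<xi> xb)) (at xb)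
        = (\<lambda>h. block own (own i) (P' (own i) ((block own (own j) h, 0), 0)))"
      by (rule frechet_derivative_at[symmetric])
    \<comment> \<open>The coordinate direction j already lies in the block of its owner, so the
      substitution in \<open>pseudohessian\<close> does not alter it.\<close>
    moreover have "block own (own j) (axis j 1) = (axis j 1 :: real ^ 'n)"
      by (auto simp: vec_eq_iff block_nth axis_def)
    ultimately show ?thesis
      by (simp add: pseudohessian_def block_nth)
  qed
  have lin: "linear (P' \<nu>)" for \<nu>
    using P' by (rule has_derivative_linear)
  have "(\<chi> i. P' (own i) (h, 0) $ i) = pseudohessian own l xb yb *v fst h + adjoint ?T (snd h)" for h
  proof -
    have "P' (own i) (h, 0) $ i = (pseudohessian own l xb yb *v fst h) $ i + adjoint ?T (snd h) $ i" for i
    proof -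
      have "linear (\<lambda>h. P' (own i) ((h, 0), 0) $ i)"
      proof (rule linearI)
        fix x y :: "real ^ 'n" and r :: real
        show "P' (own i) ((x + y, 0), 0) $ i = P' (own i) ((x, 0), 0) $ i + P' (own i) ((y, 0), 0) $ i"
          using linear_add[OF lin[of "own i"], of "((x, 0), 0)" "((y, 0), 0)"] by simp
        show "P' (own i) ((r *\<^sub>R x, 0), 0) $ i = r *\<^sub>R P' (own i) ((x, 0), 0) $ i"
          using linear_scale[OF lin[of "own i"], of r "((x, 0), 0)"] by simp
      qed
      from linear_eq_sum_axis[OF this, of "fst h"]
      have "P' (own i) ((fst h, 0), 0) $ i = (pseudohessian own l xb yb *v fst h) $ i"
        by (simp add: matrix_vector_mult_def G mult.commute)
      moreover have "P' (own i) (h, 0) = P' (own i) ((fst h, 0), 0) + P' (own i) ((0, snd h), 0)"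
        by (simp flip: linear_add[OF lin])
      ultimately show ?thesis
        by (simp add: P'y)
    qed
    then show ?thesis
      by (simp add: vec_eq_iff)
  qed
  then have sum: "(\<Sum>\<nu>\<in>UNIV. block own \<nu> (P' \<nu> (h, 0))) = pseudohessian own l xb yb *v fst h + adjoint ?T (snd h)" for h
    by (simp add: sum_block)
  have "((\<lambda>z. \<Sum>\<nu>\<in>UNIV. block own \<nu> (?P \<nu> (z, wb))) has_derivative
      (\<lambda>h. \<Sum>\<nu>\<in>UNIV. block own \<nu> (P' \<nu> (h, 0)))) (at (xb, yb))"
    by (intro has_derivative_sum P'z
        bounded_linear.has_derivative[OF linear_block[unfolded linear_conv_bounded_linear]])
  moreover have "((\<lambda>z. - F (fst z, wb)) has_derivative (\<lambda>h. - ?T (fst h))) (at (xb, yb))"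
  proof -
    have "((\<lambda>\<xi>. F (\<xi>, wb)) has_derivative ?T) (at (fst (xb, yb)))"
      using has_derivative_D\<^sub>x[OF Fd[OF nbhd(2)]] by simp
    from has_derivative_minus[OF has_derivative_compose[OF has_derivative_fst[OF has_derivative_ident] this]]
    show ?thesis .
  qed
  ultimately have "((\<lambda>z. (\<Sum>\<nu>\<in>UNIV. block own \<nu> (?P \<nu> (z, wb)), - F (fst z, wb))) has_derivative
      (\<lambda>h. (\<Sum>\<nu>\<in>UNIV. block own \<nu> (P' \<nu> (h, 0)), - ?T (fst h)))) (at (xb, yb))"
    by (rule has_derivative_Pair)
  then show ?thesis
    unfolding sum by (simp add: sum_block residual_map_def[abs_def])
qed

text \<open>The off-diagonal blocks T* and -T are negative adjoints of each other, so taking the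
  adjoint transposes G and flips the sign of the coupling.\<close>

lemma adjoint_saddle_map:
  fixes G :: "real ^ 'n::finite ^ 'n" and T :: "real ^ 'n \<Rightarrow> 'y::euclidean_space"
  assumes "linear T"
  shows "adjoint (\<lambda>h. (G *v fst h + adjoint T (snd h), - T (fst h)))
    = (\<lambda>\<zeta>. (transpose G *v fst \<zeta> - adjoint T (snd \<zeta>), T (fst \<zeta>)))"
proof (rule adjoint_unique, intro allI)
  fix h \<zeta> :: "(real ^ 'n) \<times> 'y"
  have "(G *v fst h) \<bullet> fst \<zeta> = fst h \<bullet> (transpose G *v fst \<zeta>)"
    by (metis dot_lmul_matrix inner_commute transpose_matrix_vector)
  moreover have "adjoint T (snd h) \<bullet> fst \<zeta> = snd h \<bullet> T (fst \<zeta>)"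
    "T (fst h) \<bullet> snd \<zeta> = fst h \<bullet> adjoint T (snd \<zeta>)"
    by (simp_all add: adjoint_works[OF assms] inner_commute)
  ultimately show "(G *v fst h + adjoint T (snd h), - T (fst h)) \<bullet> \<zeta>
      = h \<bullet> (transpose G *v fst \<zeta> - adjoint T (snd \<zeta>), T (fst \<zeta>))"
    by (simp add: inner_prod_def inner_add_left inner_diff_right)
qed

section \<open>The coderivative criterion for consensus equilibria\<close>

theorem theorem3p1:
  fixes own :: "'n::finite \<Rightarrow> 'p::finite"
    and X :: "'p \<Rightarrow> (real ^ 'n) set"
    and K :: "'y::euclidean_space set"
    and f :: "'p \<Rightarrow> (real ^ 'n) \<times> (real ^ 'd::finite) \<Rightarrow> real"
    and F :: "(real ^ 'n) \<times> (real ^ 'd) \<Rightarrow> 'y"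
    and wb :: "real ^ 'd" and xb :: "real ^ 'n" and yb :: 'y
    and W :: "((real ^ 'n) \<times> (real ^ 'd)) set"
    and \<theta> :: "'p \<Rightarrow> real ^ 'n \<Rightarrow> real" and g :: "real ^ 'n \<Rightarrow> 'y"
    and l :: "'p \<Rightarrow> real ^ 'n \<Rightarrow> 'y \<Rightarrow> real"
    and G :: "real ^ 'n ^ 'n" and Dg :: "real ^ 'n \<Rightarrow> 'y" and q1 :: "real ^ 'n"
  assumes X: "\<And>\<nu>. X \<nu> \<subseteq> block_space own \<nu>" "\<And>\<nu>. X \<nu> \<noteq> {}"
      "\<And>\<nu>. closed (X \<nu>)" "\<And>\<nu>. convex (X \<nu>)"
    and K: "K \<noteq> {}" "closed K" "convex K" "cone K"
    and sol: "(xb, yb) \<in> S_Lag own f F X K (wb, 0, 0)"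
    and nbhd: "open W" "(xb, wb) \<in> W"
    and twice: "\<And>\<nu> z. z \<in> W \<Longrightarrow> twice_differentiable_x (f \<nu>) z"
      "\<And>z. z \<in> W \<Longrightarrow> twice_differentiable_x F z"
    and strict: "\<And>\<nu> z. z \<in> W \<Longrightarrow> strictly_differentiable (f \<nu>) z"
      "\<And>z. z \<in> W \<Longrightarrow> strictly_differentiable F z"
      "\<And>\<nu> z. z \<in> W \<Longrightarrow> strictly_differentiable (grad\<^sub>x (f \<nu>)) z"
      "\<And>z. z \<in> W \<Longrightarrow> strictly_differentiable (D\<^sub>x F) z"
    and \<theta>: "\<theta> = (\<lambda>\<nu> x. f \<nu> (x, wb))"
    and g: "g = (\<lambda>x. F (x, wb))"
    and l: "l = (\<lambda>\<nu> x y. \<theta> \<nu> x + y \<bullet> g x)"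
    and Dg: "Dg = frechet_derivative g (at xb)"
    and G: "G = pseudohessian own l xb yb"
    and q1: "q1 = pseudogradient own l xb yb - G *v xb - adjoint Dg yb"
  shows "aubin_property (S_Lag own f F X K) (wb, 0, 0) (xb, yb) \<longleftrightarrow>
    (\<forall>w1 w2.
      transpose G *v w1 - adjoint Dg w2
        \<in> coderivative (normal_cone (block_product own X)) xb
             (- q1 - G *v xb - adjoint Dg yb) (- w1) \<and>
      Dg w1 \<in> coderivative (normal_cone (polar K)) yb (g xb) (- w2)
      \<longrightarrow> w1 = 0 \<and> w2 = 0)"
proof -
  let ?N = "\<lambda>z. normal_cone (block_product own X) (fst z) \<times> normal_cone (polar K) (snd z)"
  let ?H = "residual_map own f F"
  \<comment> \<open>The sign change turns the constraint perturbation u into the second component of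
    the translation r = (v, -u).\<close>
  define \<phi> :: "(real ^ 'd) \<times> (real ^ 'n) \<times> 'y \<Rightarrow> (real ^ 'd) \<times> (real ^ 'n) \<times> 'y"
    where "\<phi> p = (fst p, fst (snd p), - snd (snd p))" for p
  define A where "A h = (G *v fst h + adjoint Dg (snd h), - Dg (fst h))" for h :: "(real ^ 'n) \<times> 'y"
  have l': "l = (\<lambda>\<nu> x y. f \<nu> (x, wb) + y \<bullet> F (x, wb))"
    by (simp add: l \<theta> g)
  have diff: "(\<lambda>\<xi>. f \<nu> (\<xi>, w)) differentiable (at x)" "(\<lambda>\<xi>. F (\<xi>, w)) differentiable (at x)"
    if "(x, w) \<in> W" for \<nu> x w
    using strict(1,2) that by (auto intro: strictly_differentiable_imp_differentiable_slice)
  have Dg': "Dg = blinfun_apply (D\<^sub>x F (xb, wb))"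
    by (simp add: Dg g blinfun_apply_D\<^sub>x[OF diff(2)[OF nbhd(2)]])
  have linear_Dg: "linear Dg"
    unfolding Dg' by (simp add: blinfun.bounded_linear_right bounded_linear.linear)
  \<comment> \<open>The neighborhood W restricts x and w only; the multiplier y ranges over the
    whole space.\<close>
  interpret generalized_equation ?N ?H "\<lambda>p. S_Lag own f F X K (\<phi> p)" "{q. (fst (fst q), snd q) \<in> W}"
    "(xb, yb)" wb 0 A
  proof
    show "closed (gph ?N)"
      using X(3) by (intro closed_gph_Times closed_gph_normal_cone closed_block_product closed_polar)
    show "open {q. (fst (fst q), snd q) \<in> W}"
      using open_vimage[OF nbhd(1), of "\<lambda>q. (fst (fst q), snd q)"]
      by (simp add: vimage_def continuous_intros)
    show "((xb, yb), wb) \<in> {q. (fst (fst q), snd q) \<in> W}"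
      using nbhd(2) by simp
    show "z \<in> S_Lag own f F X K (\<phi> (w, r)) \<longleftrightarrow> r - ?H (z, w) \<in> ?N z"
      if "(z, w) \<in> {q. (fst (fst q), snd q) \<in> W}" for z w r
      using S_Lag_iff_residual[where own = own and X = X and f = f and F = F and x = "fst z" and w = w
          and y = "snd z" and K = K and v = "fst r" and u = "- snd r", OF X(1) diff] that
      by (simp add: \<phi>_def)
    show "strictly_differentiable ?H q" if "q \<in> {q. (fst (fst q), snd q) \<in> W}" for q
      using strictly_differentiable_residual_map[of f "fst (fst q)" "snd q" F own "snd (fst q)"] that strict(2-4)
      by simp
    show "(xb, yb) \<in> S_Lag own f F X K (\<phi> (wb, 0))"
      using sol by (simp add: \<phi>_def)
    show "((\<lambda>z. ?H (z, wb)) has_derivative A) (at (xb, yb))"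
      using has_derivative_residual_map[where own = own and yb = yb,
          OF nbhd strict(1,2) strict(3)[OF nbhd(2)] strict(4)[OF nbhd(2)]]
      unfolding A_def G l' Dg' .
  qed
  have "aubin_property (S_Lag own f F X K) (\<phi> (wb, 0)) (xb, yb)
      \<longleftrightarrow> aubin_property (\<lambda>p. S_Lag own f F X K (\<phi> p)) (wb, 0) (xb, yb)"
  proof (rule aubin_property_isometry)
    show "norm (\<phi> a - \<phi> b) = norm (a - b)" for a b
    proof -
      have "\<phi> a - \<phi> b = (fst (a - b), fst (snd (a - b)), - snd (snd (a - b)))"
        by (simp add: \<phi>_def)
      then show ?thesis
        by (simp only: norm_prod_def fst_conv snd_conv norm_minus_cancel)
    qed
    show "surj \<phi>"
      by (rule surjI[of _ \<phi>]) (simp add: \<phi>_def)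
  qed
  also have "\<dots> \<longleftrightarrow> (\<forall>\<zeta>. (adjoint A \<zeta>, \<zeta>) \<in> limiting_normal_cone (gph ?N)
      ((xb, yb), 0 - ?H ((xb, yb), wb)) \<longrightarrow> \<zeta> = 0)"
    by (rule aubin_iff_coderivative_criterion)
  \<comment> \<open>By the choice of \<open>q1\<close> the first component is minus the
    pseudogradient, which agrees coordinatewise with the residual.\<close>
  also have "0 - ?H ((xb, yb), wb) = (- q1 - G *v xb - adjoint Dg yb, g xb)"
  proof -
    have "lag_gradient f F (own i) ((xb, yb), wb) $ i = pseudogradient own l xb yb $ i" for i
      using block_grad_eqI[OF has_derivative_lagrangian[of f "own i" wb xb F yb, OF diff[OF nbhd(2)]], of own "own i"]
      by (simp add: pseudogradient_def l' block_nth)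
    then show ?thesis
      by (simp add: residual_map_def q1 g vec_eq_iff)
  qed
  also have "adjoint A = (\<lambda>\<zeta>. (transpose G *v fst \<zeta> - adjoint Dg (snd \<zeta>), Dg (fst \<zeta>)))"
    unfolding A_def[abs_def] by (rule adjoint_saddle_map[OF linear_Dg])
  finally show ?thesis
    \<comment> \<open>With \<zeta> = (w1, w2) the product rule separates the two graphs; the
      arguments - w1 and - w2 cancel the sign in the definition of the coderivative.\<close>
    by (simp add: \<phi>_def coderivative_def split_paired_All limiting_normal_cone_gph_Times prod_eq_iff)
qed

end
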